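(* Let $\lambda\in\mathbb{C}^*$, $b\in\mathbb{C}$, and let $g(y),g'(y)\in\mathbb{C}[y]$ be nonzero polynomials with $g(y)=(y-b)g'(y)$. Let $\Psi_{\mathfrak{ns}}(\lambda)=\mathbb{C}[x,y]\oplus\mathbb{C}[s,t]$ be the associated module over the Neveu-Schwarz algebra $\mathfrak{ns}$, and for $h(y)\in\mathbb{C}[y]$ let $R_h^{\mathfrak{ns}}$ be its submodule $h(y)\mathbb{C}[x,y]\oplus h(t)\mathbb{C}[s,t]$. Then, as $\mathfrak{ns}$-modules, $R_{g'}^{\mathfrak{ns}}/R_g^{\mathfrak{ns}}\cong\Phi_{\mathfrak{ns}}(\lambda,b)$. In particular, if $b\neq0$, this quotient module is irreducible.
   Context: All vector spaces are over $\mathbb{C}$; all modules (and submodules) over Lie superalgebras are $\mathbb{Z}_2$-graded; $\mathbb{C}^*$ is the set of nonzero complex numbers. The Neveu-Schwarz algebra $\mathfrak{ns}$ is the Lie superalgebra with even basis elements $L_m$ ($m\in\mathbb{Z}$), $C_1$ and odd basis elements $G_p$ ($p\in\mathbb{Z}+\frac12$), and brackets $[L_m,L_n]=(m-n)L_{m+n}+\delta_{m+n,0}\frac{m^3-m}{12}C_1$, $[L_m,G_p]=(\frac m2-p)G_{m+p}$, $[G_p,G_q]=2L_{p+q}+\delta_{p+q,0}\frac{4p^2-1}{12}C_1$, with $C_1$ central. $\Psi_{\mathfrak{ns}}(\lambda)$ is the $\mathfrak{ns}$-module with even part $\mathbb{C}[x,y]$, odd part $\mathbb{C}[s,t]$ and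 actions (for a two-variable polynomial $f$, $m\in\mathbb{Z}$, $p\in\mathbb{Z}+\frac12$): $L_mf(x,y)=\lambda^m(x+my)f(x+m,y)$, $L_mf(s,t)=\lambda^m(s+m(t+\frac12))f(s+m,t)$, $G_pf(x,y)=\lambda^{p-\frac12}f(s+p,t)$, $G_pf(s,t)=\lambda^{p+\frac12}(x+2py)f(x+p,y)$, $C_1$ acts as $0$. $\Phi_{\mathfrak{ns}}(\lambda,b)$ is the $\mathfrak{ns}$-module with even part $\mathbb{C}[x]$, odd part $\mathbb{C}[s]$ and actions (for a one-variable polynomial $f$): $L_mf(x)=\lambda^m(x+mb)f(x+m)$, $L_mf(s)=\lambda^m(s+m(b+\frac12))f(s+m)$, $G_pf(x)=\lambda^{p-\frac12}f(s+p)$, $G_pf(s)=\lambda^{p+\frac12}(x+2pb)f(x+p)$, $C_1$ acts as $0$. *)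

theory Defs
  imports
    "HOL-Algebra.Algebraic_Closure_Type"
    "HOL-Library.Poly_Mapping"
    "HOL-Library.Product_Plus"
    "HOL-Library.Z2"
begin

section \<open>Lie superalgebras over the complex numbers and their modules\<close>

abbreviation complex_ring :: "complex ring" where
  "complex_ring \<equiv> ring_of_type_algebra"

text \<open>
  Complex vector spaces are HOL-Algebra modules over \<^const>\<open>complex_ring\<close>; the inherited fields
  \<^const>\<open>monoid.mult\<close> and \<^const>\<open>one\<close> are never used. The parity of a homogeneous element
  is an element of the two-element field \<^typ>\<open>bit\<close>.
\<close>

record 'v superspace = "(complex, 'v) module" +
  part :: "bit \<Rightarrow> 'v set"

record 'g lie_superalgebra = "'g superspace" +
  bracket :: "'g \<Rightarrow> 'g \<Rightarrow> 'g"

record ('g, 'v) lie_supermodule = "'v superspace" +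
  act :: "'g \<Rightarrow> 'v \<Rightarrow> 'v"

text \<open>The sign \<open>(-1)\<^sup>i\<^sup>j\<close> of the super sign rule.\<close>

definition koszul :: "bit \<Rightarrow> bit \<Rightarrow> complex" where
  "koszul i j = (if i = 1 \<and> j = 1 then -1 else 1)"

locale superspace = module complex_ring V
  for V :: "('v, 'x) superspace_scheme" (structure) +
  assumes part_submodule: "submodule (part V i) complex_ring V"
    and part_sum: "v \<in> carrier V \<Longrightarrow> \<exists>u\<in>part V 0. \<exists>w\<in>part V 1. v = u \<oplus> w"
    and part_inter: "part V 0 \<inter> part V 1 = {\<zero>}"

locale lie_superalgebra = superspace \<gg>
  for \<gg> :: "'g lie_superalgebra" (structure) +
  assumes bracket_closed:
      "\<lbrakk>x \<in> carrier \<gg>; y \<in> carrier \<gg>\<rbrakk> \<Longrightarrow> bracket \<gg> x y \<in> carrier \<gg>"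
    and bracket_add_left:
      "\<lbrakk>x \<in> carrier \<gg>; y \<in> carrier \<gg>; z \<in> carrier \<gg>\<rbrakk> \<Longrightarrow>
        bracket \<gg> (x \<oplus> y) z = bracket \<gg> x z \<oplus> bracket \<gg> y z"
    and bracket_add_right:
      "\<lbrakk>x \<in> carrier \<gg>; y \<in> carrier \<gg>; z \<in> carrier \<gg>\<rbrakk> \<Longrightarrow>
        bracket \<gg> x (y \<oplus> z) = bracket \<gg> x y \<oplus> bracket \<gg> x z"
    and bracket_smult_left:
      "\<lbrakk>x \<in> carrier \<gg>; y \<in> carrier \<gg>\<rbrakk> \<Longrightarrow>
        bracket \<gg> (c \<odot>\<^bsub>\<gg>\<^esub> x) y = c \<odot>\<^bsub>\<gg>\<^esub> bracket \<gg> x y"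
    and bracket_smult_right:
      "\<lbrakk>x \<in> carrier \<gg>; y \<in> carrier \<gg>\<rbrakk> \<Longrightarrow>
        bracket \<gg> x (c \<odot>\<^bsub>\<gg>\<^esub> y) = c \<odot>\<^bsub>\<gg>\<^esub> bracket \<gg> x y"
    and bracket_part:
      "\<lbrakk>x \<in> part \<gg> i; y \<in> part \<gg> j\<rbrakk> \<Longrightarrow> bracket \<gg> x y \<in> part \<gg> (i + j)"
    and bracket_skew:
      "\<lbrakk>x \<in> part \<gg> i; y \<in> part \<gg> j\<rbrakk> \<Longrightarrow>
        bracket \<gg> y x = (- koszul i j) \<odot>\<^bsub>\<gg>\<^esub> bracket \<gg> x y"
    and bracket_jacobi:
      "\<lbrakk>x \<in> part \<gg> i; y \<in> part \<gg> j; z \<in> part \<gg> k\<rbrakk> \<Longrightarrow>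
        bracket \<gg> x (bracket \<gg> y z) =
          bracket \<gg> (bracket \<gg> x y) z \<oplus> koszul i j \<odot>\<^bsub>\<gg>\<^esub> bracket \<gg> y (bracket \<gg> x z)"

locale lie_supermodule = \<gg>?: lie_superalgebra \<gg> + superspace M
  for \<gg> :: "'g lie_superalgebra" and M :: "('g, 'v) lie_supermodule" (structure) +
  assumes act_closed:
      "\<lbrakk>x \<in> carrier \<gg>; v \<in> carrier M\<rbrakk> \<Longrightarrow> act M x v \<in> carrier M"
    and act_add_left:
      "\<lbrakk>x \<in> carrier \<gg>; y \<in> carrier \<gg>; v \<in> carrier M\<rbrakk> \<Longrightarrow>
        act M (x \<oplus>\<^bsub>\<gg>\<^esub> y) v = act M x v \<oplus> act M y v"
    and act_add_right:
      "\<lbrakk>x \<in> carrier \<gg>; v \<in> carrier M; w \<in> carrier M\<rbrakk> \<Longrightarrow>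
        act M x (v \<oplus> w) = act M x v \<oplus> act M x w"
    and act_smult_left:
      "\<lbrakk>x \<in> carrier \<gg>; v \<in> carrier M\<rbrakk> \<Longrightarrow> act M (c \<odot>\<^bsub>\<gg>\<^esub> x) v = c \<odot>\<^bsub>M\<^esub> act M x v"
    and act_smult_right:
      "\<lbrakk>x \<in> carrier \<gg>; v \<in> carrier M\<rbrakk> \<Longrightarrow> act M x (c \<odot>\<^bsub>M\<^esub> v) = c \<odot>\<^bsub>M\<^esub> act M x v"
    and act_part:
      "\<lbrakk>x \<in> part \<gg> i; v \<in> part M j\<rbrakk> \<Longrightarrow> act M x v \<in> part M (i + j)"
    and act_bracket:
      "\<lbrakk>x \<in> part \<gg> i; y \<in> part \<gg> j; v \<in> carrier M\<rbrakk> \<Longrightarrow>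
        act M (bracket \<gg> x y) v =
          act M x (act M y v) \<ominus>\<^bsub>M\<^esub> koszul i j \<odot>\<^bsub>M\<^esub> act M y (act M x v)"

definition graded_submodule ::
    "'g lie_superalgebra \<Rightarrow> 'v set \<Rightarrow> ('g, 'v) lie_supermodule \<Rightarrow> bool" where
  "graded_submodule \<gg> W M \<longleftrightarrow>
     submodule W complex_ring M \<and>
     (\<forall>v\<in>W. \<exists>u\<in>W \<inter> part M 0. \<exists>w\<in>W \<inter> part M 1. v = u \<oplus>\<^bsub>M\<^esub> w) \<and>
     (\<forall>x\<in>carrier \<gg>. \<forall>v\<in>W. act M x v \<in> W)"

definition restrict_module ::
    "('g, 'v) lie_supermodule \<Rightarrow> 'v set \<Rightarrow> ('g, 'v) lie_supermodule" where
  "restrict_module M W = M\<lparr>carrier := W, part := \<lambda>i. part M i \<inter> W\<rparr>"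

text \<open>
  The elements of the quotient module are the additive cosets of \<open>W\<close>. The operations are
  \<open>c \<cdot> (W + v) = W + c v\<close> and \<open>x \<cdot> (W + v) = W + x v\<close>; as in \<^const>\<open>rcoset_mult\<close>, the union over
  all representatives avoids a choice.
\<close>

definition quotient_module ::
    "('g, 'v) lie_supermodule \<Rightarrow> 'v set \<Rightarrow> ('g, 'v set) lie_supermodule" where
  "quotient_module M W =
     \<lparr>carrier = a_rcosets\<^bsub>M\<^esub> W, monoid.mult = undefined, one = undefined,
      ring.zero = W, add = set_add M,
      module.smult = (\<lambda>c A. \<Union>v\<in>A. W +>\<^bsub>M\<^esub> (c \<odot>\<^bsub>M\<^esub> v)),
      part = (\<lambda>i. (\<lambda>v. W +>\<^bsub>M\<^esub> v) ` part M i),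
      act = (\<lambda>x A. \<Union>v\<in>A. W +>\<^bsub>M\<^esub> act M x v)\<rparr>"

definition supermodule_iso ::
    "'g lie_superalgebra \<Rightarrow> ('g, 'v) lie_supermodule \<Rightarrow> ('g, 'w) lie_supermodule \<Rightarrow>
      ('v \<Rightarrow> 'w) \<Rightarrow> bool" where
  "supermodule_iso \<gg> M N \<phi> \<longleftrightarrow>
     bij_betw \<phi> (carrier M) (carrier N) \<and>
     (\<forall>v\<in>carrier M. \<forall>w\<in>carrier M. \<phi> (v \<oplus>\<^bsub>M\<^esub> w) = \<phi> v \<oplus>\<^bsub>N\<^esub> \<phi> w) \<and>
     (\<forall>c. \<forall>v\<in>carrier M. \<phi> (c \<odot>\<^bsub>M\<^esub> v) = c \<odot>\<^bsub>N\<^esub> \<phi> v) \<and>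
     (\<forall>i. \<phi> ` part M i \<subseteq> part N i) \<and>
     (\<forall>x\<in>carrier \<gg>. \<forall>v\<in>carrier M. \<phi> (act M x v) = act N x (\<phi> v))"

definition isomorphic_modules ::
    "'g lie_superalgebra \<Rightarrow> ('g, 'v) lie_supermodule \<Rightarrow> ('g, 'w) lie_supermodule \<Rightarrow> bool" where
  "isomorphic_modules \<gg> M N \<longleftrightarrow>
     lie_supermodule \<gg> M \<and> lie_supermodule \<gg> N \<and> (\<exists>\<phi>. supermodule_iso \<gg> M N \<phi>)"

definition irreducible_module ::
    "'g lie_superalgebra \<Rightarrow> ('g, 'v) lie_supermodule \<Rightarrow> bool" where
  "irreducible_module \<gg> M \<longleftrightarrow>
     lie_supermodule \<gg> M \<and> carrier M \<noteq> {\<zero>\<^bsub>M\<^esub>} \<and>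
     (\<forall>W. graded_submodule \<gg> W M \<longrightarrow> W = {\<zero>\<^bsub>M\<^esub>} \<or> W = carrier M)"


section \<open>The Neveu-Schwarz algebra\<close>

text \<open>
  \<open>Lgen m\<close> is \<open>L\<^sub>m\<close> and \<open>Cgen\<close> is the central element. The odd basis elements are
  indexed by integers: \<open>Ggen k\<close> is \<open>G\<^sub>p\<close> with \<open>p = k + 1/2\<close>. Hence
  \<open>G\<^bsub>m+p\<^esub>\<close> is \<open>Ggen (m + k)\<close>, and for \<open>q = l + 1/2\<close> the sum \<open>p + q\<close> is \<open>k + l + 1\<close>.
\<close>

datatype ns_basis = Lgen int | Cgen | Ggen int

abbreviation half :: "int \<Rightarrow> complex" where
  "half k \<equiv> of_int k + 1 / 2"

type_synonym ns = "ns_basis \<Rightarrow>\<^sub>0 complex"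

fun ns_parity :: "ns_basis \<Rightarrow> bit" where
  "ns_parity (Lgen m) = 0"
| "ns_parity Cgen = 0"
| "ns_parity (Ggen k) = 1"

fun ns_basis_bracket :: "ns_basis \<Rightarrow> ns_basis \<Rightarrow> ns" where
  "ns_basis_bracket (Lgen m) (Lgen n) =
     Poly_Mapping.single (Lgen (m + n)) (of_int (m - n)) +
     Poly_Mapping.single Cgen (if m + n = 0 then (of_int m ^ 3 - of_int m) / 12 else 0)"
| "ns_basis_bracket (Lgen m) (Ggen k) =
     Poly_Mapping.single (Ggen (m + k)) (of_int m / 2 - half k)"
| "ns_basis_bracket (Ggen k) (Lgen m) =
     Poly_Mapping.single (Ggen (m + k)) (- (of_int m / 2 - half k))"
| "ns_basis_bracket (Ggen k) (Ggen l) =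
     Poly_Mapping.single (Lgen (k + l + 1)) 2 +
     Poly_Mapping.single Cgen (if k + l + 1 = 0 then (4 * half k ^ 2 - 1) / 12 else 0)"
| "ns_basis_bracket Cgen _ = 0"
| "ns_basis_bracket _ Cgen = 0"

definition linear_ext ::
    "(complex \<Rightarrow> 'v \<Rightarrow> 'v) \<Rightarrow> (ns_basis \<Rightarrow> 'v::comm_monoid_add) \<Rightarrow> ns \<Rightarrow> 'v" where
  "linear_ext scale F x = (\<Sum>a\<in>Poly_Mapping.keys x. scale (Poly_Mapping.lookup x a) (F a))"

definition ns_scale :: "complex \<Rightarrow> ns \<Rightarrow> ns" where
  "ns_scale c x = Poly_Mapping.map ((*) c) x"

definition ns_algebra :: "ns lie_superalgebra" where
  "ns_algebra =
     \<lparr>carrier = UNIV, monoid.mult = undefined, one = undefined,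
      ring.zero = 0, add = (+), module.smult = ns_scale,
      part = (\<lambda>i. {x. \<forall>a\<in>Poly_Mapping.keys x. ns_parity a = i}),
      bracket = (\<lambda>x y. linear_ext ns_scale
        (\<lambda>a. linear_ext ns_scale (\<lambda>b. ns_basis_bracket a b) y) x)\<rparr>"


section \<open>The modules \<open>\<Psi>(\<lambda>)\<close> and \<open>\<Phi>(\<lambda>, b)\<close>\<close>

text \<open>
  \<open>V \<oplus> V\<close>, with even part the first and odd part the second summand, where each basis element
  \<open>a\<close> of \<open>ns\<close> acts by \<open>A a\<close>.
\<close>

definition ns_pair_module ::
    "(complex \<Rightarrow> 'e \<Rightarrow> 'e) \<Rightarrow> (ns_basis \<Rightarrow> 'e \<times> 'e \<Rightarrow> 'e \<times> 'e) \<Rightarrow>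
      (ns, 'e::ab_group_add \<times> 'e) lie_supermodule" where
  "ns_pair_module scale A =
     \<lparr>carrier = UNIV, monoid.mult = undefined, one = undefined,
      ring.zero = 0, add = (+),
      module.smult = (\<lambda>c. map_prod (scale c) (scale c)),
      part = (\<lambda>i. if i = 0 then {v. snd v = 0} else {v. fst v = 0}),
      act = (\<lambda>x v. linear_ext (\<lambda>c. map_prod (scale c) (scale c)) (\<lambda>a. A a v) x)\<rparr>"

text \<open>
  \<open>\<complex>[x, y]\<close> and \<open>\<complex>[s, t]\<close> are both represented by the type \<^typ>\<open>complex poly poly\<close> of polynomials
  in \<open>x\<close> (respectively \<open>s\<close>) with coefficients in \<open>\<complex>[y]\<close> (respectively \<open>\<complex>[t]\<close>). Thus
  \<open>f(x + c, y)\<close> is \<open>f \<circ>\<^sub>p (X2 + K2 c)\<close>, and \<open>h(y) f(x, y)\<close> is \<open>Polynomial.smult h f\<close>.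
\<close>

abbreviation (input) K2 :: "complex \<Rightarrow> complex poly poly" where "K2 c \<equiv> [:[:c:]:]"
abbreviation (input) X2 :: "complex poly poly" where "X2 \<equiv> [:0, 1:]"
abbreviation (input) Y2 :: "complex poly poly" where "Y2 \<equiv> [:[:0, 1:]:]"

text \<open>
  For \<open>p = k + 1/2\<close> the exponents \<open>p - 1/2\<close> and \<open>p + 1/2\<close> of \<open>\<lambda>\<close> are the integers \<open>k\<close> and \<open>k + 1\<close>.
\<close>

fun Psi_act :: "complex \<Rightarrow> ns_basis \<Rightarrow> complex poly poly \<times> complex poly poly \<Rightarrow>
    complex poly poly \<times> complex poly poly" where
  "Psi_act lam (Lgen m) (f, h) =
     (K2 (lam powi m) * (X2 + K2 (of_int m) * Y2) * (f \<circ>\<^sub>p (X2 + K2 (of_int m))),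
      K2 (lam powi m) * (X2 + K2 (of_int m) * (Y2 + K2 (1 / 2))) * (h \<circ>\<^sub>p (X2 + K2 (of_int m))))"
| "Psi_act lam (Ggen k) (f, h) =
     (K2 (lam powi (k + 1)) * (X2 + K2 (2 * half k) * Y2) * (h \<circ>\<^sub>p (X2 + K2 (half k))),
      K2 (lam powi k) * (f \<circ>\<^sub>p (X2 + K2 (half k))))"
| "Psi_act lam Cgen (f, h) = (0, 0)"

definition Psi :: "complex \<Rightarrow> (ns, complex poly poly \<times> complex poly poly) lie_supermodule" where
  "Psi lam = ns_pair_module (\<lambda>c f. K2 c * f) (Psi_act lam)"

definition R_ns :: "complex poly \<Rightarrow> (complex poly poly \<times> complex poly poly) set" where
  "R_ns h = {(Polynomial.smult h f1, Polynomial.smult h f2) | f1 f2. True}"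

abbreviation (input) K1 :: "complex \<Rightarrow> complex poly" where "K1 c \<equiv> [:c:]"
abbreviation (input) X1 :: "complex poly" where "X1 \<equiv> [:0, 1:]"

fun Phi_act :: "complex \<Rightarrow> complex \<Rightarrow> ns_basis \<Rightarrow> complex poly \<times> complex poly \<Rightarrow>
    complex poly \<times> complex poly" where
  "Phi_act lam b (Lgen m) (f, h) =
     (K1 (lam powi m) * (X1 + K1 (of_int m * b)) * (f \<circ>\<^sub>p (X1 + K1 (of_int m))),
      K1 (lam powi m) * (X1 + K1 (of_int m * (b + 1 / 2))) * (h \<circ>\<^sub>p (X1 + K1 (of_int m))))"
| "Phi_act lam b (Ggen k) (f, h) =
     (K1 (lam powi (k + 1)) * (X1 + K1 (2 * half k * b)) * (h \<circ>\<^sub>p (X1 + K1 (half k))),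
      K1 (lam powi k) * (f \<circ>\<^sub>p (X1 + K1 (half k))))"
| "Phi_act lam b Cgen (f, h) = (0, 0)"

definition Phi :: "complex \<Rightarrow> complex \<Rightarrow> (ns, complex poly \<times> complex poly) lie_supermodule" where
  "Phi lam b = ns_pair_module (\<lambda>c f. K1 c * f) (Phi_act lam b)"


section \<open>\<open>ns\<close> is a Lie superalgebra, \<open>\<Psi>(\<lambda>)\<close> and \<open>\<Phi>(\<lambda>, b)\<close> are modules, \<open>R\<^sub>h\<close> is a submodule\<close>

lemma lookup_ns_scale [simp]: "Poly_Mapping.lookup (ns_scale c x) a = c * Poly_Mapping.lookup x a"
  unfolding ns_scale_def by (simp add: Poly_Mapping.map.rep_eq when_def)

lemma vector_space_ns: "vector_space ns_scale"
  by unfold_locales (auto intro!: poly_mapping_eqI simp: lookup_add algebra_simps)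

locale complex_vs = vector_space scale
  for scale :: "complex \<Rightarrow> 'v \<Rightarrow> 'v::ab_group_add"
begin

lemma linear_ext_eq:
  assumes "finite A" "Poly_Mapping.keys x \<subseteq> A"
  shows "linear_ext scale F x = (\<Sum>a\<in>A. scale (Poly_Mapping.lookup x a) (F a))"
  unfolding linear_ext_def
  by (rule sum.mono_neutral_left) (use assms in \<open>auto simp: in_keys_iff\<close>)

lemma linear_ext_add: "linear_ext scale F (x + y) = linear_ext scale F x + linear_ext scale F y"
proof -
  let ?A = "Poly_Mapping.keys x \<union> Poly_Mapping.keys y"
  have "Poly_Mapping.keys (x + y) \<subseteq> ?A" by (rule keys_add)
  then show ?thesis
    by (simp add: linear_ext_eq[of ?A] lookup_add scale_left_distrib sum.distrib)
qed

lemma linear_ext_ns_scale: "linear_ext scale F (ns_scale c x) = scale c (linear_ext scale F x)"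
proof -
  have "Poly_Mapping.keys (ns_scale c x) \<subseteq> Poly_Mapping.keys x" by (auto simp: in_keys_iff)
  then show ?thesis
    by (simp add: linear_ext_eq[of "Poly_Mapping.keys x"] scale_sum_right)
qed

lemma linear_ext_single [simp]: "linear_ext scale F (Poly_Mapping.single a c) = scale c (F a)"
  by (subst linear_ext_eq[of "{a}"]) auto

lemma linear_ext_zero [simp]: "linear_ext scale F 0 = 0"
  by (simp add: linear_ext_def)

lemma linear_ext_fun_add:
  "linear_ext scale (\<lambda>a. F a + H a) x = linear_ext scale F x + linear_ext scale H x"
  by (simp add: linear_ext_def scale_right_distrib sum.distrib)

lemma linear_ext_fun_scale:
  "linear_ext scale (\<lambda>a. scale c (F a)) x = scale c (linear_ext scale F x)"
  by (simp add: linear_ext_def scale_sum_right mult.commute)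

end

lemma ns_induct [consumes 1, case_names zero single add]:
  assumes x: "\<forall>a\<in>Poly_Mapping.keys x. Q a"
    and "P 0" and s: "\<And>a c. Q a \<Longrightarrow> P (Poly_Mapping.single a c)"
    and p: "\<And>x y. P x \<Longrightarrow> P y \<Longrightarrow> P (x + y)"
  shows "P (x :: ns)"
proof -
  have eq: "x = (\<Sum>a\<in>Poly_Mapping.keys x. Poly_Mapping.single a (Poly_Mapping.lookup x a))"
    by (rule poly_mapping_eqI)
       (auto simp: lookup_sum lookup_single when_def in_keys_iff sum.delta)
  have "finite B \<Longrightarrow> B \<subseteq> Poly_Mapping.keys x \<Longrightarrow>
     P (\<Sum>a\<in>B. Poly_Mapping.single a (Poly_Mapping.lookup x a))" for B
    by (induction B rule: finite_induct) (use assms in auto)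
  from this[of "Poly_Mapping.keys x"] show ?thesis using eq by simp
qed

interpretation ns: complex_vs ns_scale by (rule complex_vs.intro, rule vector_space_ns)

abbreviation "brk \<equiv> bracket ns_algebra"

lemma brk_add_left: "brk (x + y) z = brk x z + brk y z"
  by (simp add: ns_algebra_def ns.linear_ext_add)
lemma brk_add_right: "brk x (y + z) = brk x y + brk x z"
  by (simp add: ns_algebra_def ns.linear_ext_add ns.linear_ext_fun_add)
lemma brk_scale_left: "brk (ns_scale c x) y = ns_scale c (brk x y)"
  by (simp add: ns_algebra_def ns.linear_ext_ns_scale)
lemma brk_scale_right: "brk x (ns_scale c y) = ns_scale c (brk x y)"
  by (simp add: ns_algebra_def ns.linear_ext_ns_scale ns.linear_ext_fun_scale)
lemma brk_zero [simp]: "brk 0 x = 0" "brk x 0 = 0"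
  by (simp_all add: ns_algebra_def linear_ext_def)
lemma ns_scale_single [simp]: "ns_scale c (Poly_Mapping.single a d) = Poly_Mapping.single a (c * d)"
  by (rule poly_mapping_eqI) (auto simp: lookup_single when_def)
lemma brk_single: "brk (Poly_Mapping.single a c) (Poly_Mapping.single b d) =
   ns_scale (c * d) (ns_basis_bracket a b)"
  by (simp add: ns_algebra_def)

lemma ns_basis_bracket_parity:
  "c \<in> Poly_Mapping.keys (ns_basis_bracket a b) \<Longrightarrow> ns_parity c = ns_parity a + ns_parity b"
  by (cases a; cases b) (auto dest!: subsetD[OF keys_add] split: if_splits)

lemma ns_basis_bracket_skew:
  "ns_basis_bracket b a = ns_scale (- koszul (ns_parity a) (ns_parity b)) (ns_basis_bracket a b)"
proof (rule poly_mapping_eqI)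
  fix c
  show "Poly_Mapping.lookup (ns_basis_bracket b a) c =
    Poly_Mapping.lookup (ns_scale (- koszul (ns_parity a) (ns_parity b)) (ns_basis_bracket a b)) c"
  proof (cases a; cases b)
    fix m n assume ab: "a = Lgen m" "b = Lgen n"
    show ?thesis
    proof (cases "m + n = 0")
      case True
      then have n: "n = - m" by simp
      show ?thesis
        by (simp add: ab n lookup_add lookup_minus lookup_single when_def koszul_def diff_divide_distrib)
    next
      case False
      then have "n + m \<noteq> 0" by (simp add: add.commute)
      with False show ?thesis
        by (simp add: ab add.commute[of n m] lookup_add lookup_single when_def koszul_def)
    qed
  next
    fix k l assume ab: "a = Ggen k" "b = Ggen l"
    show ?thesis
    proof (cases "k + l + 1 = 0")
      case True
      then have l: "l = - k - 1" by simp
      show ?thesis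
        by (simp add: ab l lookup_add lookup_single when_def koszul_def power2_eq_square algebra_simps)
    next
      case False
      then show ?thesis
        by (simp add: ab add.commute[of l k] lookup_add lookup_single when_def koszul_def)
    qed
  qed (auto simp: lookup_add lookup_single when_def koszul_def)
qed

lemma ns_basis_jacobi:
  "brk (Poly_Mapping.single a 1) (ns_basis_bracket b c) =
   brk (ns_basis_bracket a b) (Poly_Mapping.single c 1) +
   ns_scale (koszul (ns_parity a) (ns_parity b)) (brk (Poly_Mapping.single b 1) (ns_basis_bracket a c))"
proof -
  have sum0: "P" if "i + j = (0::int)" "i = - j \<Longrightarrow> P" for i j P
    using that by (simp add: eq_neg_iff_add_eq_0)
  show ?thesis
    apply (cases a; cases b; cases c)
    apply (auto intro!: poly_mapping_eqI simp: brk_add_left brk_add_right brk_single lookup_add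
         lookup_single when_def koszul_def ac_simps)
    apply ((erule sum0, hypsubst)?, simp add: algebra_simps add_divide_distrib diff_divide_distrib
           power2_eq_square power3_eq_cube)+
    done
qed


lemma koszul_swap: "koszul i j = koszul j i" and koszul_square [simp]: "koszul i j * koszul i j = 1"
  by (auto simp: koszul_def)

lemma superspace_UNIV:
  assumes "complex_vs scale" "carrier V = UNIV" "add V = (+)" "ring.zero V = 0"
    "module.smult V = scale"
    and P: "\<And>i. 0 \<in> part V i" "\<And>i v w. v \<in> part V i \<Longrightarrow> w \<in> part V i \<Longrightarrow> v + w \<in> part V i"
     "\<And>i c v. v \<in> part V i \<Longrightarrow> scale c v \<in> part V i"
     "\<And>v. \<exists>u\<in>part V 0. \<exists>w\<in>part V 1. v = u + w" "part V 0 \<inter> part V 1 = {0}"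
  shows "superspace V" and "a_minus V v w = v - w"
proof -
  interpret complex_vs scale by fact
  have ab: "abelian_group V"
    by (rule abelian_groupI) (use assms(2-5) in \<open>auto simp: ac_simps intro: exI[of _ "- x" for x]\<close>)
  interpret abelian_group V by (rule ab)
  have neg: "\<ominus>\<^bsub>V\<^esub> x = - x" for x
    by (rule minus_equality) (use assms(2-5) in auto)
  show "a_minus V v w = v - w" by (simp add: a_minus_def neg assms)
  interpret m: module complex_ring V
    by (rule moduleI, rule cring_from_type_algebra, rule ab)
       (use assms(2-5) ab in \<open>auto simp: ring_of_type_algebra_def[where 'a=complex] scale_left_distrib scale_right_distrib\<close>)
  show "superspace V"
  proof (intro superspace.intro superspace_axioms.intro m.module_axioms)
    fix i
    show "submodule (part V i) complex_ring V"
    proof (rule m.submoduleI)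
      fix v assume "v \<in> part V i"
      from P(3)[OF this, of "-1"] show "\<ominus>\<^bsub>V\<^esub> v \<in> part V i" by (simp add: neg)
    qed (use assms in auto)
  qed (use assms in auto)
qed


lemma ns_algebra_simps:
  "carrier ns_algebra = UNIV" "add ns_algebra = (+)" "ring.zero ns_algebra = 0"
  "module.smult ns_algebra = ns_scale"
  "part ns_algebra i = {x. \<forall>a\<in>Poly_Mapping.keys x. ns_parity a = i}"
  by (simp_all add: ns_algebra_def)

lemma ns_part_add:
  "u \<in> part ns_algebra i \<Longrightarrow> w \<in> part ns_algebra i \<Longrightarrow> u + w \<in> part ns_algebra i"
  using keys_add[of u w] by (auto simp: ns_algebra_simps)

lemma ns_part_scale: "u \<in> part ns_algebra i \<Longrightarrow> ns_scale c u \<in> part ns_algebra i"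
  by (auto simp: ns_algebra_simps in_keys_iff)

lemma ns_part_zero: "0 \<in> part ns_algebra i"
  by (simp add: ns_algebra_simps)

lemma ns_part_single: "Poly_Mapping.single a c \<in> part ns_algebra (ns_parity a)"
  by (simp add: ns_algebra_simps)

lemma lie_superalgebra_ns: "lie_superalgebra ns_algebra"
proof -
  have split: "\<exists>u\<in>part ns_algebra 0. \<exists>w\<in>part ns_algebra 1. v = u + w" for v
  proof -
    have "\<forall>a\<in>Poly_Mapping.keys v. True" by simp
    then show ?thesis
    proof (induction v rule: ns_induct)
      case zero
      show ?case by (rule bexI[OF bexI[OF _ ns_part_zero] ns_part_zero]) simp
    next
      case (single a c)
      consider "ns_parity a = 0" | "ns_parity a = 1" by (cases a) auto
      then show ?case
      proof cases
        case 1
        then show ?thesis using ns_part_single[of a c] by (metis ns_part_zero add.right_neutral)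
      next
        case 2
        then show ?thesis using ns_part_single[of a c] by (metis ns_part_zero add.left_neutral)
      qed
    next
      case (add x y)
      then obtain u w u' w' where "u \<in> part ns_algebra 0" "u' \<in> part ns_algebra 0"
        "w \<in> part ns_algebra 1" "w' \<in> part ns_algebra 1" "x = u + w" "y = u' + w'"
        by blast
      then have "u + u' \<in> part ns_algebra 0" "w + w' \<in> part ns_algebra 1"
        and "x + y = (u + u') + (w + w')"
        by (simp_all add: ns_part_add ac_simps)
      then show ?case by blast
    qed
  qed
  have inter: "part ns_algebra 0 \<inter> part ns_algebra 1 = {0}"
  proof (intro equalityI subsetI)
    fix x assume "x \<in> part ns_algebra 0 \<inter> part ns_algebra 1"
    then have "Poly_Mapping.keys x = {}" by (auto simp: ns_algebra_simps)
    then show "x \<in> {0}" by simp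
  qed (auto simp: ns_algebra_simps)
  have sp: "superspace ns_algebra"
    by (rule superspace_UNIV(1)[OF ns.complex_vs_axioms ns_algebra_simps(1-4) ns_part_zero
          ns_part_add ns_part_scale split inter])
  have part: "brk x y \<in> part ns_algebra (i + j)"
    if "x \<in> part ns_algebra i" "y \<in> part ns_algebra j" for x y i j
  proof -
    from that(1)[unfolded ns_algebra_simps mem_Collect_eq] show ?thesis
    proof (induction x rule: ns_induct)
      case (single a c)
      from that(2)[unfolded ns_algebra_simps mem_Collect_eq] show ?case
      proof (induction y rule: ns_induct)
        case (single b d)
        have "ns_basis_bracket a b \<in> part ns_algebra (i + j)"
          using single \<open>ns_parity a = i\<close> ns_basis_bracket_parity[of _ a b]
          by (auto simp: ns_algebra_simps)
        then show ?case by (simp add: brk_single ns_part_scale)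
      qed (simp_all add: brk_add_right ns_part_add ns_part_zero)
    qed (simp_all add: brk_add_left ns_part_add ns_part_zero)
  qed
  have skew: "brk y x = ns_scale (- koszul i j) (brk x y)"
    if "x \<in> part ns_algebra i" "y \<in> part ns_algebra j" for x y i j
    using that(1)[unfolded ns_algebra_simps mem_Collect_eq]
  proof (induction x rule: ns_induct)
    case (single a c)
    from that(2)[unfolded ns_algebra_simps mem_Collect_eq] show ?case
    proof (induction y rule: ns_induct)
      case (single b d)
      with \<open>ns_parity a = i\<close> show ?case
        by (simp add: brk_single ns_basis_bracket_skew[of b a] mult.commute)
    qed (simp_all add: brk_add_right brk_add_left ns.scale_right_distrib)
  qed (simp_all add: brk_add_right brk_add_left ns.scale_right_distrib)
  have one: "Poly_Mapping.single a c = ns_scale c (Poly_Mapping.single a 1)" for a c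
    by simp
  have jac1: "brk (Poly_Mapping.single a c) (brk (Poly_Mapping.single b d) (Poly_Mapping.single e f)) =
     brk (brk (Poly_Mapping.single a c) (Poly_Mapping.single b d)) (Poly_Mapping.single e f) +
     ns_scale (koszul (ns_parity a) (ns_parity b))
       (brk (Poly_Mapping.single b d) (brk (Poly_Mapping.single a c) (Poly_Mapping.single e f)))"
    for a b e c d f
    unfolding one[of a c] one[of b d] one[of e f] brk_scale_left brk_scale_right
    by (simp add: brk_single[of _ 1 _ 1] ns_basis_jacobi[of a b e] ns.scale_right_distrib ac_simps
      del: ns_scale_single)
  have jac: "brk x (brk y z) = brk (brk x y) z + ns_scale (koszul i j) (brk y (brk x z))"
    if "x \<in> part ns_algebra i" "y \<in> part ns_algebra j" "z \<in> part ns_algebra k" for x y z i j k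
    using that(1)[unfolded ns_algebra_simps mem_Collect_eq]
  proof (induction x rule: ns_induct)
    case (single a c)
    from that(2)[unfolded ns_algebra_simps mem_Collect_eq] show ?case
    proof (induction y rule: ns_induct)
      case (single b d)
      from that(3)[unfolded ns_algebra_simps mem_Collect_eq] show ?case
      proof (induction z rule: ns_induct)
        case (single e f)
        show ?case using jac1[of a c b d e f] \<open>ns_parity a = i\<close> \<open>ns_parity b = j\<close> by simp
      qed (simp_all add: brk_add_right brk_add_left ns.scale_right_distrib)
    qed (simp_all add: brk_add_right brk_add_left ns.scale_right_distrib)
  qed (simp_all add: brk_add_right brk_add_left ns.scale_right_distrib)
  show ?thesis
    by (intro lie_superalgebra.intro lie_superalgebra_axioms.intro sp, unfold ns_algebra_simps(1-4))
       (assumption | rule UNIV_I brk_add_left brk_add_right brk_scale_left brk_scale_right part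
          skew jac)+
qed

abbreviation pair_scale :: "(complex \<Rightarrow> 'e \<Rightarrow> 'e) \<Rightarrow> complex \<Rightarrow> 'e \<times> 'e \<Rightarrow> 'e \<times> 'e" where
  "pair_scale scale c \<equiv> map_prod (scale c) (scale c)"

lemma lie_supermodule_pair:
  fixes scale :: "complex \<Rightarrow> 'e::ab_group_add \<Rightarrow> 'e"
  assumes vs: "vector_space scale"
    and A_add: "\<And>a v w. A a (v + w) = A a v + A a w"
    and A_scale: "\<And>a c v. A a (pair_scale scale c v) = pair_scale scale c (A a v)"
    and A_part: "\<And>a v. ns_parity a = 0 \<Longrightarrow> fst v = 0 \<Longrightarrow> fst (A a v) = 0"
        "\<And>a v. ns_parity a = 0 \<Longrightarrow> snd v = 0 \<Longrightarrow> snd (A a v) = 0"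
        "\<And>a v. ns_parity a = 1 \<Longrightarrow> fst v = 0 \<Longrightarrow> snd (A a v) = 0"
        "\<And>a v. ns_parity a = 1 \<Longrightarrow> snd v = 0 \<Longrightarrow> fst (A a v) = 0"
    and A_rel: "\<And>a b v. linear_ext (pair_scale scale) (\<lambda>c. A c v) (ns_basis_bracket a b) =
       A a (A b v) - pair_scale scale (koszul (ns_parity a) (ns_parity b)) (A b (A a v))"
  shows "lie_supermodule ns_algebra (ns_pair_module scale A)"
proof -
  interpret s: vector_space scale by fact
  let ?S = "pair_scale scale"
  interpret S: complex_vs ?S
    by (intro complex_vs.intro vector_space.intro)
       (auto simp: s.scale_right_distrib s.scale_left_distrib)
  let ?M = "ns_pair_module scale A"
  have M: "carrier ?M = UNIV" "add ?M = (+)" "ring.zero ?M = 0" "module.smult ?M = ?S"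
    "part ?M i = (if i = 0 then {v. snd v = 0} else {v. fst v = 0})"
    "act ?M x v = linear_ext ?S (\<lambda>a. A a v) x" for i x v
    by (simp_all add: ns_pair_module_def)
  have add_cl: "u + w \<in> part ?M i" if "u \<in> part ?M i" "w \<in> part ?M i" for u w i
    using that by (auto simp: M split: if_splits)
  have sc_cl: "?S c w \<in> part ?M i" if "w \<in> part ?M i" for w i c
    using that by (auto simp: M split: if_splits)
  have z_cl: "0 \<in> part ?M i" for i by (auto simp: M)
  have split: "\<exists>u\<in>part ?M 0. \<exists>w\<in>part ?M 1. v = u + w" for v
    by (rule bexI[of _ "(fst v, 0)"], rule bexI[of _ "(0, snd v)"]) (auto simp: M)
  have inter: "part ?M 0 \<inter> part ?M 1 = {0}"
    by (auto simp: M zero_prod_def prod_eq_iff)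
  note sp = superspace_UNIV[OF S.complex_vs_axioms M(1-4) z_cl add_cl sc_cl split inter]
  have minus: "a_minus ?M v w = v - w" for v w by (rule sp(2))
  have act_add: "act ?M x (v + w) = act ?M x v + act ?M x w" for x v w
    by (simp add: M A_add S.linear_ext_fun_add)
  have act_sc: "act ?M x (?S c v) = ?S c (act ?M x v)" for x c v
    by (simp add: M A_scale S.linear_ext_fun_scale)
  have act_addl: "act ?M (x + y) v = act ?M x v + act ?M y v" for x y v
    by (simp add: M S.linear_ext_add)
  have act_scl: "act ?M (ns_scale c x) v = ?S c (act ?M x v)" for x c v
    by (simp add: M S.linear_ext_ns_scale)
  have act_single: "act ?M (Poly_Mapping.single a c) v = ?S c (A a v)" for a c v
    by (simp add: M)
  have act_0: "act ?M 0 v = 0" for v by (simp add: M)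
  have act_z: "act ?M x 0 = 0" for x using act_add[of x 0 0] by simp
  have part: "act ?M x v \<in> part ?M (i + j)"
    if "x \<in> part ns_algebra i" "v \<in> part ?M j" for x v i j
    using that(1)[unfolded ns_algebra_simps mem_Collect_eq]
  proof (induction x rule: ns_induct)
    case (single a c)
    have "A a v \<in> part ?M (i + j)"
      using that(2) single A_part[of a v] by (cases i; cases j) (auto simp: M)
    then show ?case by (simp add: act_single sc_cl)
  qed (simp_all add: act_0 act_addl z_cl add_cl)
  have rel: "act ?M (brk x y) v = act ?M x (act ?M y v) - ?S (koszul i j) (act ?M y (act ?M x v))"
    if "x \<in> part ns_algebra i" "y \<in> part ns_algebra j" for x y v i j
    using that(1)[unfolded ns_algebra_simps mem_Collect_eq]
  proof (induction x rule: ns_induct)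
    case (single a c)
    from that(2)[unfolded ns_algebra_simps mem_Collect_eq] show ?case
    proof (induction y rule: ns_induct)
      case (single b d)
      have "act ?M (ns_basis_bracket a b) v = A a (A b v) - ?S (koszul i j) (A b (A a v))"
        using A_rel[of v a b] \<open>ns_parity a = i\<close> single by (simp add: M)
      then show ?case
        by (simp add: brk_single act_scl act_single A_scale S.scale_right_diff_distrib ac_simps)
    qed (simp_all add: brk_add_right act_addl act_add act_0 act_z S.scale_right_distrib)
  qed (simp_all add: brk_add_left act_addl act_add act_0 act_z S.scale_right_distrib)
  show ?thesis
    by (intro lie_supermodule.intro lie_supermodule_axioms.intro lie_superalgebra_ns sp(1),
        unfold ns_algebra_simps(1-4) M(1-4) minus)
       (assumption | rule UNIV_I act_add act_sc act_addl act_scl part rel)+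
qed

locale ns_family =
  fixes k :: "complex \<Rightarrow> 'r::comm_ring_1 poly" and Y :: "'r poly" and lam :: complex
  assumes k_add: "k (c + d) = k c + k d" and k_mult: "k (c * d) = k c * k d" and k_one: "k 1 = 1"
    and comp_k: "k c \<circ>\<^sub>p f = k c" and comp_Y: "Y \<circ>\<^sub>p f = Y" and lam: "lam \<noteq> 0"
begin

definition xx :: "'r poly" where "xx = [:0, 1:]"

fun fam :: "ns_basis \<Rightarrow> 'r poly \<times> 'r poly \<Rightarrow> 'r poly \<times> 'r poly" where
  "fam (Lgen m) (f, h) =
     (k (lam powi m) * (xx + k (of_int m) * Y) * (f \<circ>\<^sub>p (xx + k (of_int m))),
      k (lam powi m) * (xx + k (of_int m) * (Y + k (1 / 2))) * (h \<circ>\<^sub>p (xx + k (of_int m))))"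
| "fam (Ggen j) (f, h) =
     (k (lam powi (j + 1)) * (xx + k (2 * half j) * Y) * (h \<circ>\<^sub>p (xx + k (half j))),
      k (lam powi j) * (f \<circ>\<^sub>p (xx + k (half j))))"
| "fam Cgen (f, h) = (0, 0)"

lemma k_zero: "k 0 = 0" using k_add[of 0 0] by simp
lemma k_minus: "k (- c) = - k c" using k_add[of c "- c"] k_zero by (simp add: add_eq_0_iff)
lemma k_diff: "k (c - d) = k c - k d" using k_add[of c "- d"] k_minus by simp
lemma k_numeral: "k (numeral w) = numeral w"
proof -
  have "k (of_nat n) = of_nat n" for n by (induction n) (auto simp: k_zero k_add k_one)
  from this[of "numeral w"] show ?thesis by simp
qed
lemma k_half: "2 * k (1 / 2) = 1"
  using k_mult[of 2 "1/2"] by (simp add: k_numeral k_one)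
lemma k_div2: "k (c / 2) = k c * k (1/2)" using k_mult[of c "1/2"] by simp

lemmas k_simps = k_zero k_minus k_diff k_add k_mult k_one k_numeral comp_k comp_Y

lemma X_comp: "xx \<circ>\<^sub>p f = f" by (simp add: xx_def pcompose_pCons)

lemma vs: "vector_space (\<lambda>c f. k c * f)"
  by unfold_locales (simp_all add: algebra_simps k_simps)

lemma powi_add: "lam powi (m + n) = lam powi m * lam powi n"
  by (rule power_int_add) (use lam in auto)

lemma pair: "lie_supermodule ns_algebra (ns_pair_module (\<lambda>c f. k c * f) fam)"
proof (rule lie_supermodule_pair[OF vs])
  fix a v w show "fam a (v + w) = fam a v + fam a w"
    by (cases a; cases v; cases w) (simp_all add: pcompose_add algebra_simps zero_prod_def)
next
  fix a c v show "fam a (pair_scale (\<lambda>c f. k c * f) c v) = pair_scale (\<lambda>c f. k c * f) c (fam a v)"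
    by (cases a; cases v) (simp_all add: pcompose_mult comp_k ac_simps)
next
  fix a b and v :: "'r poly \<times> 'r poly"
  let ?S = "pair_scale (\<lambda>c f. k c * f)"
  have S: "complex_vs ?S"
    by (intro complex_vs.intro vector_space.intro) (auto simp: algebra_simps k_simps)
  define E where "E = linear_ext ?S (\<lambda>c. fam c v)"
  have E_add: "E (x + y) = E x + E y" and E_single: "E (Poly_Mapping.single c d) = ?S d (fam c v)"
    and E_zero: "E 0 = 0" for x y c d
    unfolding E_def by (rule complex_vs.linear_ext_add[OF S] complex_vs.linear_ext_single[OF S]
      complex_vs.linear_ext_zero[OF S])+
  have E_C: "E (Poly_Mapping.single Cgen c) = 0" for c
    by (cases v) (simp add: E_single zero_prod_def)
  note lin = ns_basis_bracket.simps E_add E_C E_single add_0_right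
  obtain f h where v: "v = (f, h)" by (cases v)
  define H where "H = k (1/2)"
  have H: "2 * H = 1" using k_half by (simp add: H_def)
  have k_H: "k (c / 2) = k c * H" for c unfolding H_def by (rule k_div2)
  have H1: "H * z + H * z = z" for z
  proof -
    have "H * z + H * z = 2 * H * z" by (simp add: algebra_simps)
    then show ?thesis by (simp add: H)
  qed
  have H2: "H * z + (H * z + w) = z + w" for z w
    using H1[of z] by (simp add: add.assoc[symmetric])
  have H3: "H * (z * 2) = z" for z
    using H1[of z] by (simp add: algebra_simps)
  have H4: "H * 2 = 1" and H5: "H + H = 1" and H6: "H + (H + z) = 1 + z" for z
    using H1[of 1] H2[of 1] by (simp_all add: algebra_simps)
  have H7: "H * (2 * z) = z" "H * (u * (2 * z)) = u * z" "H * (u * (w * (2 * z))) = u * (w * z)"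
    "H * (u * (w * (x * (2 * z)))) = u * (w * (x * z))" for u w x z
    using H3[of z] H3[of "u * z"] H3[of "u * w * z"] H3[of "u * w * x * z"]
    by (simp_all add: ac_simps)
  note HH = H1 H2 H3 H4 H5 H6 H7
  have z: "ns_basis_bracket c Cgen = 0" for c by (cases c) auto
  have l1: "lam powi (n + 1) = lam powi n * lam" for n using powi_add[of n 1] by simp
  have comp_num: "(numeral w :: 'r poly) \<circ>\<^sub>p q = numeral w" "1 \<circ>\<^sub>p q = 1" for w and q :: "'r poly"
    using comp_k[of "numeral w" q] comp_k[of 1 q] by (simp_all only: k_numeral k_one)
  have comp_H: "H \<circ>\<^sub>p q = H" for q by (simp add: H_def comp_k)
  have "E (ns_basis_bracket a b) =
       fam a (fam b v) - ?S (koszul (ns_parity a) (ns_parity b)) (fam b (fam a v))"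
  proof (cases a; cases b)
    fix m n assume ab: "a = Lgen m" "b = Lgen n"
    show ?thesis
      unfolding ab lin
      apply (simp add: v comp_H koszul_def pcompose_mult pcompose_add X_comp pcompose_assoc[symmetric] comp_num powi_add l1 k_simps k_H ac_simps)
      apply (simp_all add: algebra_simps HH)
      done
  next
    fix m n assume ab: "a = Lgen m" "b = Ggen n"
    show ?thesis
      unfolding ab lin
      apply (simp add: v comp_H koszul_def pcompose_mult pcompose_add X_comp pcompose_assoc[symmetric] comp_num powi_add l1 k_simps k_H ac_simps)
      apply (simp_all add: algebra_simps HH)
      done
  next
    fix m n assume ab: "a = Ggen m" "b = Lgen n"
    show ?thesis
      unfolding ab lin
      apply (simp add: v comp_H koszul_def pcompose_mult pcompose_add X_comp pcompose_assoc[symmetric] comp_num powi_add l1 k_simps k_H ac_simps)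
      apply (simp_all add: algebra_simps HH)
      done
  next
    fix m n assume ab: "a = Ggen m" "b = Ggen n"
    show ?thesis
      unfolding ab lin
      apply (simp add: v comp_H koszul_def pcompose_mult pcompose_add X_comp pcompose_assoc[symmetric] comp_num powi_add l1 k_simps k_H ac_simps)
      apply (simp_all add: algebra_simps HH)
      done
  qed (simp_all add: v z E_zero koszul_def zero_prod_def k_zero)
  then show "linear_ext ?S (\<lambda>c. fam c v) (ns_basis_bracket a b) =
       fam a (fam b v) - ?S (koszul (ns_parity a) (ns_parity b)) (fam b (fam a v))"
    by (simp only: E_def)
next
qed (auto simp: k_zero elim!: ns_parity.elims)

end

lemma Psi_module:
  assumes "lam \<noteq> 0"
  shows "lie_supermodule ns_algebra (Psi lam)"
proof -
  interpret ns_family K2 Y2 lam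
    by unfold_locales (use assms in \<open>simp_all add: one_pCons\<close>)
  have "Psi_act lam a v = fam a v" for a v
    by (cases a; cases v) (simp_all add: xx_def)
  then have "Psi_act lam = fam" by (intro ext)
  then show ?thesis using pair by (simp add: Psi_def)
qed

lemma Phi_module:
  assumes "lam \<noteq> 0"
  shows "lie_supermodule ns_algebra (Phi lam b)"
proof -
  interpret ns_family K1 "[:b:]" lam
    by unfold_locales (use assms in \<open>simp_all add: one_pCons\<close>)
  have "Phi_act lam b a v = fam a v" for a v
    by (cases a; cases v) (simp_all add: xx_def ac_simps)
  then have "Phi_act lam b = fam" by (intro ext)
  then show ?thesis using pair by (simp add: Phi_def)
qed

lemma R_ns_add: "v \<in> R_ns h \<Longrightarrow> w \<in> R_ns h \<Longrightarrow> v + w \<in> R_ns h"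
  by (auto simp: R_ns_def smult_add_right[symmetric])

lemma R_ns_zero: "0 \<in> R_ns h"
  by (auto simp: R_ns_def zero_prod_def intro!: exI[of _ 0])

lemma R_ns_scale: "v \<in> R_ns h \<Longrightarrow> pair_scale (\<lambda>c f. K2 c * f) c v \<in> R_ns h"
  by (auto simp: R_ns_def simp del: smult_smult mult_pCons_left)

lemma R_ns_Psi_act: "v \<in> R_ns h \<Longrightarrow> Psi_act lam a v \<in> R_ns h"
proof -
  assume "v \<in> R_ns h"
  then obtain f1 f2 where v: "v = (Polynomial.smult h f1, Polynomial.smult h f2)"
    by (auto simp: R_ns_def)
  have c: "Polynomial.smult h f \<circ>\<^sub>p q = Polynomial.smult h (f \<circ>\<^sub>p q)" for f q
    by (rule pcompose_smult)
  have m: "q * Polynomial.smult h f = Polynomial.smult h (q * f)" for f q :: "complex poly poly"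
    by (rule mult_smult_right)
  have z: "(0, 0) \<in> R_ns h" using R_ns_zero by (simp add: zero_prod_def)
  show ?thesis
    by (cases a) (simp_all only: v c m Psi_act.simps z, auto simp only: R_ns_def)
qed

lemma R_ns_submodule:
  assumes "lam \<noteq> 0"
  shows "graded_submodule ns_algebra (R_ns h) (Psi lam)"
proof -
  interpret lie_supermodule ns_algebra "Psi lam" by (rule Psi_module) fact
  let ?M = "Psi lam"
  have M: "carrier ?M = UNIV" "add ?M = (+)" "ring.zero ?M = 0"
    "module.smult ?M = pair_scale (\<lambda>c f. K2 c * f)"
    "part ?M i = (if i = 0 then {v. snd v = 0} else {v. fst v = 0})"
    "act ?M x v = (\<Sum>a\<in>Poly_Mapping.keys x.
       pair_scale (\<lambda>c f. K2 c * f) (Poly_Mapping.lookup x a) (Psi_act lam a v))" for i x v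
    by (simp_all add: ns_pair_module_def Psi_def linear_ext_def)
  have K2_neg: "K2 (-1) = - 1" by (simp add: one_pCons)
  have neg: "\<ominus>\<^bsub>?M\<^esub> v = pair_scale (\<lambda>c f. K2 c * f) (-1) v" for v
  proof (rule M.minus_equality)
    show "pair_scale (\<lambda>c f. K2 c * f) (-1) v \<oplus>\<^bsub>?M\<^esub> v = \<zero>\<^bsub>?M\<^esub>"
      using K2_neg by (cases v) (simp add: M(2-4) zero_prod_def del: mult_pCons_left minus_pCons)
  qed (simp_all add: M)
  have "submodule (R_ns h) complex_ring ?M"
  proof (rule submoduleI)
    show "\<ominus>\<^bsub>?M\<^esub> v \<in> R_ns h" if "v \<in> R_ns h" for v
      unfolding neg by (rule R_ns_scale) fact
  qed (use R_ns_add R_ns_zero R_ns_scale in \<open>simp_all add: M(1-4)\<close>)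
  moreover have "\<exists>u\<in>R_ns h \<inter> part ?M 0. \<exists>w\<in>R_ns h \<inter> part ?M 1. v = u \<oplus>\<^bsub>?M\<^esub> w"
    if "v \<in> R_ns h" for v
  proof -
    from that obtain f1 f2 where v: "v = (Polynomial.smult h f1, Polynomial.smult h f2)"
      by (auto simp: R_ns_def)
    have "(Polynomial.smult h f1, 0) \<in> R_ns h" "(0, Polynomial.smult h f2) \<in> R_ns h"
      by (auto simp: R_ns_def intro: exI[of _ 0])
    then show ?thesis
      by (intro bexI[of _ "(Polynomial.smult h f1, 0)"] bexI[of _ "(0, Polynomial.smult h f2)"])
         (simp_all add: v M)
  qed
  moreover have "act ?M x v \<in> R_ns h" if "v \<in> R_ns h" for x v
  proof -
    have "(\<Sum>a\<in>B. pair_scale (\<lambda>c f. K2 c * f) (Poly_Mapping.lookup x a) (Psi_act lam a v)) \<in> R_ns h"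
      if "finite B" for B
      using that by (induction B rule: finite_induct)
        (simp_all add: R_ns_zero R_ns_add R_ns_scale R_ns_Psi_act \<open>v \<in> R_ns h\<close> del: mult_pCons_left)
    then show ?thesis by (simp only: M finite_keys)
  qed
  ultimately show ?thesis by (simp add: graded_submodule_def)
qed

end

theory Submission
  imports Defs
begin

text \<open>
  The module \<open>R\<^sub>h\<close> is the image of \<open>\<Psi>(\<lambda>)\<close> under multiplication by \<open>h(y)\<close>, an injective map that
  commutes with the action because \<open>ns\<close> only multiplies by polynomials and shifts \<open>x\<close>. So
  \<open>R\<^sub>g\<^sub>' / R\<^sub>g\<close> is \<open>\<Psi>(\<lambda>)\<close> modulo the multiples of \<open>y - b\<close>, and setting \<open>y = b\<close> (and \<open>t = b\<close>) turns the
  formulas for \<open>\<Psi>(\<lambda>)\<close> into those for \<open>\<Phi>(\<lambda>, b)\<close>. Formally, dividing by \<open>g'\<close> and then setting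
  \<open>y = b\<close> is a surjective homomorphism \<open>R\<^sub>g\<^sub>' \<rightarrow> \<Phi>(\<lambda>, b)\<close> (\<open>divide_evalY_epi\<close>) with kernel
  \<open>R\<^sub>g\<close> (\<open>divide_evalY_kernel\<close>), and the isomorphism is an instance of the first isomorphism theorem
  for supermodules (\<open>first_isomorphism\<close>).

  For \<open>b \<noteq> 0\<close> it remains to see that \<open>\<Phi>(\<lambda>, b)\<close> is irreducible (\<open>Phi_irreducible\<close>). If \<open>p + q = 1\<close> then
  \<open>G\<^sub>q G\<^sub>p f(x) = \<lambda> (x + 2 q b) f(x + 1)\<close>. Two choices of \<open>q\<close> differ by a nonzero multiple of \<open>f(x + 1)\<close>,
  so the even part of a submodule is stable under \<open>f(x) \<mapsto> f(x + 1)\<close>. Since \<open>f(x + 1) - f(x)\<close> has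
  smaller degree than \<open>f\<close>, a nonzero element of minimal degree is constant. Then \<open>L\<^sub>0\<close>,
  which multiplies by \<open>x\<close>, produces the whole even part, and the operators \<open>G\<^sub>p\<close> the odd part.
\<close>

section \<open>Pulling back and restricting supermodules\<close>

lemma complex_ring_simps:
  "carrier complex_ring = UNIV" "c \<oplus>\<^bsub>complex_ring\<^esub> d = c + d" "c \<otimes>\<^bsub>complex_ring\<^esub> d = c * d"
  "\<one>\<^bsub>complex_ring\<^esub> = 1" "\<zero>\<^bsub>complex_ring\<^esub> = 0"
  by (simp_all add: ring_of_type_algebra_def)

lemma (in superspace) part_subset: "v \<in> part V i \<Longrightarrow> v \<in> carrier V"
  using submoduleE(1)[OF part_submodule] by blast

lemma (in superspace) zero_in_part: "\<zero> \<in> part V i"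
  using subgroup.one_closed[OF submodule.axioms(1)[OF part_submodule[of i]]] by simp

lemma (in superspace) smult_closed_UNIV: "v \<in> carrier V \<Longrightarrow> c \<odot>\<^bsub>V\<^esub> v \<in> carrier V"
  by (simp add: complex_ring_simps)

lemma (in superspace) uminus_eq_smult: "v \<in> carrier V \<Longrightarrow> \<ominus>\<^bsub>V\<^esub> v = (-1) \<odot>\<^bsub>V\<^esub> v"
proof -
  assume v: "v \<in> carrier V"
  have "(-1) \<odot>\<^bsub>V\<^esub> v \<oplus>\<^bsub>V\<^esub> v = (-1 + 1) \<odot>\<^bsub>V\<^esub> v"
    using smult_l_distr[of "-1" 1 v] smult_one[of v] v by (simp add: complex_ring_simps)
  also have "\<dots> = \<zero>" using smult_l_null[OF v] by (simp add: complex_ring_simps)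
  finally show ?thesis using v by (intro M.minus_equality smult_closed_UNIV)
qed

text \<open>
  The identities among the axioms may be checked in \<open>M\<close> after applying the injection \<open>\<psi>\<close>. Closure
  under the operations and the existence of homogeneous components do not transfer along an
  injection and are assumed. The inclusion of a submodule and the bijection of the first
  isomorphism theorem are the two instances used below.
\<close>

lemma (in lie_supermodule) pullback_supermodule:
  fixes Q :: "('g, 'c) lie_supermodule"
  assumes inj: "inj_on \<psi> (carrier Q)"
    and mem: "\<And>v. v \<in> carrier Q \<Longrightarrow> \<psi> v \<in> carrier M"
    and zero: "\<zero>\<^bsub>Q\<^esub> \<in> carrier Q" "\<psi> \<zero>\<^bsub>Q\<^esub> = \<zero>"
    and add: "\<And>v w. v \<in> carrier Q \<Longrightarrow> w \<in> carrier Q \<Longrightarrow> v \<oplus>\<^bsub>Q\<^esub> w \<in> carrier Q"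
      "\<And>v w. v \<in> carrier Q \<Longrightarrow> w \<in> carrier Q \<Longrightarrow> \<psi> (v \<oplus>\<^bsub>Q\<^esub> w) = \<psi> v \<oplus> \<psi> w"
    and smult: "\<And>c v. v \<in> carrier Q \<Longrightarrow> c \<odot>\<^bsub>Q\<^esub> v \<in> carrier Q"
      "\<And>c v. v \<in> carrier Q \<Longrightarrow> \<psi> (c \<odot>\<^bsub>Q\<^esub> v) = c \<odot>\<^bsub>M\<^esub> \<psi> v"
    and act: "\<And>x v. x \<in> carrier \<gg> \<Longrightarrow> v \<in> carrier Q \<Longrightarrow> act Q x v \<in> carrier Q"
      "\<And>x v. x \<in> carrier \<gg> \<Longrightarrow> v \<in> carrier Q \<Longrightarrow> \<psi> (act Q x v) = act M x (\<psi> v)"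
    and part: "\<And>i. part Q i = {v \<in> carrier Q. \<psi> v \<in> part M i}"
    and split: "\<And>v. v \<in> carrier Q \<Longrightarrow> \<exists>u\<in>part Q 0. \<exists>w\<in>part Q 1. v = u \<oplus>\<^bsub>Q\<^esub> w"
  shows "lie_supermodule \<gg> Q"
proof -
  have eqI: "v = w" if "v \<in> carrier Q" "w \<in> carrier Q" "\<psi> v = \<psi> w" for v w
    using inj that by (meson inj_onD)
  note hom = zero add smult act mem smult_closed_UNIV act_closed
  have ab: "abelian_group Q"
  proof (rule abelian_groupI)
    fix v assume v: "v \<in> carrier Q"
    have "(-1) \<odot>\<^bsub>Q\<^esub> v \<oplus>\<^bsub>Q\<^esub> v = \<zero>\<^bsub>Q\<^esub>"
      by (rule eqI) (use v in \<open>simp_all add: hom uminus_eq_smult[symmetric] l_neg\<close>)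
    then show "\<exists>w\<in>carrier Q. w \<oplus>\<^bsub>Q\<^esub> v = \<zero>\<^bsub>Q\<^esub>" using v smult(1) by blast
  qed (auto intro!: eqI simp: hom M.a_assoc, auto intro!: eqI simp: hom M.a_comm)
  interpret Q: module complex_ring Q
  proof (rule moduleI[OF cring_from_type_algebra ab])
  qed (auto intro!: eqI simp: hom smult_l_distr smult_r_distr smult_assoc1
        complex_ring_simps smult_one[unfolded complex_ring_simps]
        smult_l_distr[unfolded complex_ring_simps]
        smult_r_distr[unfolded complex_ring_simps] smult_assoc1[unfolded complex_ring_simps])
  have neg: "\<ominus>\<^bsub>Q\<^esub> v = (-1) \<odot>\<^bsub>Q\<^esub> v" if v: "v \<in> carrier Q" for v
  proof (rule Q.minus_equality)
    show "(-1) \<odot>\<^bsub>Q\<^esub> v \<oplus>\<^bsub>Q\<^esub> v = \<zero>\<^bsub>Q\<^esub>"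
      by (rule eqI) (use v in \<open>simp_all add: hom uminus_eq_smult[symmetric] l_neg\<close>)
  qed (use v smult in auto)
  have minus: "v \<ominus>\<^bsub>Q\<^esub> w \<in> carrier Q" "\<psi> (v \<ominus>\<^bsub>Q\<^esub> w) = \<psi> v \<ominus> \<psi> w"
    if "v \<in> carrier Q" "w \<in> carrier Q" for v w
    using that by (simp_all add: a_minus_def neg hom uminus_eq_smult)
  note P = submoduleE[OF part_submodule]
  have "superspace Q"
  proof (intro superspace.intro superspace_axioms.intro Q.module_axioms split)
    fix i show "submodule (part Q i) complex_ring Q"
      by (rule Q.submoduleI)
         (use P in \<open>auto simp: part hom neg uminus_eq_smult[symmetric] complex_ring_simps zero_in_part\<close>)
  next
    have "v = \<zero>\<^bsub>Q\<^esub>" if "v \<in> carrier Q" "\<psi> v \<in> part M 0" "\<psi> v \<in> part M 1" for v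
      using that part_inter by (intro eqI) (auto simp: zero)
    then show "part Q 0 \<inter> part Q 1 = {\<zero>\<^bsub>Q\<^esub>}"
      by (auto simp: part zero zero_in_part)
  qed
  then show ?thesis
  proof (intro lie_supermodule.intro lie_supermodule_axioms.intro \<gg>.lie_superalgebra_axioms)
    fix x y v i j
    assume a: "x \<in> part \<gg> i" "y \<in> part \<gg> j" "v \<in> carrier Q"
    note a' = a \<gg>.part_subset[OF a(1)] \<gg>.part_subset[OF a(2)]
    show "act Q (bracket \<gg> x y) v = act Q x (act Q y v) \<ominus>\<^bsub>Q\<^esub> koszul i j \<odot>\<^bsub>Q\<^esub> act Q y (act Q x v)"
      by (rule eqI) (use a' in \<open>simp_all add: hom minus \<gg>.bracket_closed act_bracket\<close>)
  next
    fix x y v assume "x \<in> carrier \<gg>" "y \<in> carrier \<gg>" "v \<in> carrier Q"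
    then show "act Q (x \<oplus>\<^bsub>\<gg>\<^esub> y) v = act Q x v \<oplus>\<^bsub>Q\<^esub> act Q y v"
      by (intro eqI) (simp_all add: hom act_add_left)
  next
    fix x v w assume "x \<in> carrier \<gg>" "v \<in> carrier Q" "w \<in> carrier Q"
    then show "act Q x (v \<oplus>\<^bsub>Q\<^esub> w) = act Q x v \<oplus>\<^bsub>Q\<^esub> act Q x w"
      by (intro eqI) (simp_all add: hom act_add_right)
  next
    fix x v c assume "x \<in> carrier \<gg>" "v \<in> carrier Q"
    then show "act Q (c \<odot>\<^bsub>\<gg>\<^esub> x) v = c \<odot>\<^bsub>Q\<^esub> act Q x v" "act Q x (c \<odot>\<^bsub>Q\<^esub> v) = c \<odot>\<^bsub>Q\<^esub> act Q x v"
      by (intro eqI; simp add: hom act_smult_left act_smult_right \<gg>.smult_closed_UNIV)+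
  next
    fix x v i j assume "x \<in> part \<gg> i" "v \<in> part Q j"
    then show "act Q x v \<in> part Q (i + j)"
      using act_part[of x i "\<psi> v" j] \<gg>.part_subset[of x i] by (simp add: part hom)
  qed (simp_all add: act)
qed

lemma (in lie_supermodule) restrict_module_supermodule:
  assumes "graded_submodule \<gg> W M"
  shows "lie_supermodule \<gg> (restrict_module M W)"
proof -
  from assms have sub: "submodule W complex_ring M"
    and split: "\<And>v. v \<in> W \<Longrightarrow> \<exists>u\<in>W \<inter> part M 0. \<exists>w\<in>W \<inter> part M 1. v = u \<oplus> w"
    and act: "\<And>x v. x \<in> carrier \<gg> \<Longrightarrow> v \<in> W \<Longrightarrow> act M x v \<in> W"
    by (simp_all add: graded_submodule_def)
  note W = submoduleE[OF sub, unfolded complex_ring_simps]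
  show ?thesis
  proof (rule pullback_supermodule[where \<psi> = "\<lambda>v. v"])
    show "\<zero>\<^bsub>restrict_module M W\<^esub> \<in> carrier (restrict_module M W)"
      using subgroup.one_closed[OF submodule.axioms(1)[OF sub]] by (simp add: restrict_module_def)
  next
    fix v assume "v \<in> carrier (restrict_module M W)"
    then show "\<exists>u\<in>part (restrict_module M W) 0. \<exists>w\<in>part (restrict_module M W) 1.
        v = u \<oplus>\<^bsub>restrict_module M W\<^esub> w"
      using split[of v] by (auto simp: restrict_module_def)
  qed (use W act in \<open>auto simp: restrict_module_def\<close>)
qed

section \<open>Homomorphisms and the first isomorphism theorem\<close>

locale supermodule_hom =
  M: lie_supermodule \<gg> M + N: lie_supermodule \<gg> N
  for \<gg> :: "'g lie_superalgebra" and M :: "('g, 'v) lie_supermodule"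
    and N :: "('g, 'w) lie_supermodule" +
  fixes \<phi> :: "'v \<Rightarrow> 'w"
  assumes hom_closed: "v \<in> carrier M \<Longrightarrow> \<phi> v \<in> carrier N"
    and hom_add: "\<lbrakk>v \<in> carrier M; w \<in> carrier M\<rbrakk> \<Longrightarrow> \<phi> (v \<oplus>\<^bsub>M\<^esub> w) = \<phi> v \<oplus>\<^bsub>N\<^esub> \<phi> w"
    and hom_smult: "v \<in> carrier M \<Longrightarrow> \<phi> (c \<odot>\<^bsub>M\<^esub> v) = c \<odot>\<^bsub>N\<^esub> \<phi> v"
    and hom_part: "v \<in> part M i \<Longrightarrow> \<phi> v \<in> part N i"
    and hom_act: "\<lbrakk>x \<in> carrier \<gg>; v \<in> carrier M\<rbrakk> \<Longrightarrow> \<phi> (act M x v) = act N x (\<phi> v)"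
begin

definition ker :: "'v set" where
  "ker = {v \<in> carrier M. \<phi> v = \<zero>\<^bsub>N\<^esub>}"

lemma hom_uminus: "v \<in> carrier M \<Longrightarrow> \<phi> (\<ominus>\<^bsub>M\<^esub> v) = \<ominus>\<^bsub>N\<^esub> \<phi> v"
  by (simp add: M.uminus_eq_smult N.uminus_eq_smult hom_smult hom_closed)

lemma hom_minus: "\<lbrakk>v \<in> carrier M; w \<in> carrier M\<rbrakk> \<Longrightarrow> \<phi> (v \<ominus>\<^bsub>M\<^esub> w) = \<phi> v \<ominus>\<^bsub>N\<^esub> \<phi> w"
  by (simp add: a_minus_def hom_add hom_uminus)

lemma hom_zero: "\<phi> \<zero>\<^bsub>M\<^esub> = \<zero>\<^bsub>N\<^esub>"
  using hom_minus[of "\<zero>\<^bsub>M\<^esub>" "\<zero>\<^bsub>M\<^esub>"] by (simp add: a_minus_def M.r_neg N.r_neg hom_closed)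

lemma coset_ker_eq:
  assumes v: "v \<in> carrier M"
  shows "ker +>\<^bsub>M\<^esub> v = {u \<in> carrier M. \<phi> u = \<phi> v}"
proof (intro equalityI subsetI)
  fix u assume "u \<in> ker +>\<^bsub>M\<^esub> v"
  then show "u \<in> {u \<in> carrier M. \<phi> u = \<phi> v}"
    using v by (auto simp: a_r_coset_def' ker_def hom_add hom_closed)
next
  fix u assume u: "u \<in> {u \<in> carrier M. \<phi> u = \<phi> v}"
  have "u \<ominus>\<^bsub>M\<^esub> v \<in> ker"
    using u v by (simp add: ker_def hom_minus hom_closed N.r_neg a_minus_def[of N])
  moreover have "u = (u \<ominus>\<^bsub>M\<^esub> v) \<oplus>\<^bsub>M\<^esub> v"
    using u v by (simp add: a_minus_def M.a_assoc M.l_neg)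
  ultimately show "u \<in> ker +>\<^bsub>M\<^esub> v"
    by (auto simp: a_r_coset_def')
qed

end

locale supermodule_epi = supermodule_hom +
  assumes surj: "w \<in> carrier N \<Longrightarrow> \<exists>v\<in>carrier M. w = \<phi> v"
begin

text \<open>
  A preimage \<open>v = u0 + u1\<close> of a homogeneous element need not be homogeneous, but the image of its
  component of the wrong parity is the difference of two elements of \<open>part N i\<close>, hence lies in both
  parts of \<open>N\<close> and vanishes.
\<close>

lemma part_lift:
  assumes v: "v \<in> carrier M" and p: "\<phi> v \<in> part N i"
  shows "\<exists>u\<in>part M i. \<phi> u = \<phi> v"
proof -
  obtain u0 u1 where u: "u0 \<in> part M 0" "u1 \<in> part M 1" "v = u0 \<oplus>\<^bsub>M\<^esub> u1"
    using M.part_sum[OF v] by blast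
  note c = u(1,2)[THEN M.part_subset] u(1,2)[THEN hom_part]
  have eq: "\<phi> v = \<phi> u0 \<oplus>\<^bsub>N\<^esub> \<phi> u1" using u c by (simp add: hom_add)
  note P = N.submoduleE[OF N.part_submodule]
  consider "i = 0" | "i = 1" by (cases i) auto
  then show ?thesis
  proof cases
    case 1
    have "\<phi> u1 = \<ominus>\<^bsub>N\<^esub> \<phi> u0 \<oplus>\<^bsub>N\<^esub> \<phi> v"
      using c by (simp add: eq hom_closed N.r_neg1)
    then have "\<phi> u1 \<in> part N 0 \<inter> part N 1" using c p 1 P(3,5) by auto
    then have "\<phi> v = \<phi> u0" using N.part_inter eq c by (simp add: hom_closed)
    then show ?thesis using u 1 by metis
  next
    case 2
    have "\<phi> u0 = \<phi> v \<oplus>\<^bsub>N\<^esub> \<ominus>\<^bsub>N\<^esub> \<phi> u1"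
      using c by (simp add: eq hom_closed N.a_assoc N.r_neg)
    then have "\<phi> u0 \<in> part N 0 \<inter> part N 1" using c p 2 P(3,5) by auto
    then have "\<phi> v = \<phi> u1" using N.part_inter eq c by (simp add: hom_closed)
    then show ?thesis using u 2 by metis
  qed
qed

text \<open>
  The cosets of the kernel are the fibres of \<open>\<phi>\<close>, so \<open>\<phi>\<close> is constant on each coset and \<open>the_elem\<close>
  reads off its value. The resulting bijection both makes the quotient a supermodule, by
  \<open>pullback_supermodule\<close>, and is the isomorphism.
\<close>

theorem first_isomorphism: "isomorphic_modules \<gg> (quotient_module M ker) N"
proof -
  let ?Q = "quotient_module M ker"
  define cl where "cl v = {u \<in> carrier M. \<phi> u = \<phi> v}" for v
  have mem_cl: "u \<in> cl v \<longleftrightarrow> u \<in> carrier M \<and> \<phi> u = \<phi> v" for u v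
    by (simp add: cl_def)
  have cl_cong: "cl u = cl v" if "\<phi> u = \<phi> v" for u v
    using that by (simp add: cl_def)
  have coset: "ker +>\<^bsub>M\<^esub> v = cl v" if "v \<in> carrier M" for v
    using that by (simp add: cl_def coset_ker_eq)
  define \<psi> where "\<psi> A = the_elem (\<phi> ` A)" for A
  have \<psi>: "\<psi> (cl v) = \<phi> v" if "v \<in> carrier M" for v
  proof -
    have "\<phi> ` cl v = {\<phi> v}" using that by (auto simp: cl_def)
    then show ?thesis by (simp add: \<psi>_def)
  qed
  have carrier: "carrier ?Q = cl ` carrier M"
    by (auto simp: quotient_module_def A_RCOSETS_def' coset)
  have Un: "(\<Union>u\<in>cl v. ker +>\<^bsub>M\<^esub> F u) = cl (F v)"
    if v: "v \<in> carrier M" and F: "\<And>u. u \<in> carrier M \<Longrightarrow> F u \<in> carrier M"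
      "\<And>u. u \<in> carrier M \<Longrightarrow> \<phi> u = \<phi> v \<Longrightarrow> \<phi> (F u) = \<phi> (F v)" for v F
  proof -
    have "ker +>\<^bsub>M\<^esub> F u = cl (F v)" if "u \<in> cl v" for u
      using that F[of u] by (auto simp: mem_cl coset intro: cl_cong)
    moreover have "v \<in> cl v" using v by (simp add: mem_cl)
    ultimately show ?thesis by blast
  qed
  have act: "act ?Q x (cl v) = cl (act M x v)" if "x \<in> carrier \<gg>" "v \<in> carrier M" for x v
    using Un[of v "act M x"] that by (simp add: quotient_module_def M.act_closed hom_act)
  have smult: "c \<odot>\<^bsub>?Q\<^esub> cl v = cl (c \<odot>\<^bsub>M\<^esub> v)" if "v \<in> carrier M" for c v
    using Un[of v "\<lambda>u. c \<odot>\<^bsub>M\<^esub> u"] that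
    by (simp add: quotient_module_def M.smult_closed_UNIV hom_smult)
  have zero: "\<zero>\<^bsub>?Q\<^esub> = cl \<zero>\<^bsub>M\<^esub>"
    by (simp add: quotient_module_def ker_def cl_def hom_zero)
  have add: "cl v \<oplus>\<^bsub>?Q\<^esub> cl w = cl (v \<oplus>\<^bsub>M\<^esub> w)" if v: "v \<in> carrier M" and w: "w \<in> carrier M" for v w
  proof -
    have "u \<in> cl v <+>\<^bsub>M\<^esub> cl w" if u: "u \<in> cl (v \<oplus>\<^bsub>M\<^esub> w)" for u
    proof -
      have "u = v \<oplus>\<^bsub>M\<^esub> (\<ominus>\<^bsub>M\<^esub> v \<oplus>\<^bsub>M\<^esub> u)" using u v by (simp add: mem_cl M.r_neg2)
      moreover have "\<ominus>\<^bsub>M\<^esub> v \<oplus>\<^bsub>M\<^esub> u \<in> cl w"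
        using u v w by (simp add: mem_cl hom_add hom_uminus N.r_neg1 hom_closed)
      ultimately show ?thesis using v mem_cl[of v v] by (auto simp: set_add_def')
    qed
    moreover have "cl v <+>\<^bsub>M\<^esub> cl w \<subseteq> cl (v \<oplus>\<^bsub>M\<^esub> w)"
      using v w by (auto simp: set_add_def' mem_cl hom_add)
    ultimately show ?thesis by (auto simp: quotient_module_def)
  qed
  have part: "part ?Q i = cl ` part M i" for i
    by (auto simp: quotient_module_def coset M.part_subset)
  have clI: "\<And>v. v \<in> carrier M \<Longrightarrow> cl v \<in> carrier ?Q" by (auto simp: carrier)
  have Q: "\<exists>v\<in>carrier M. A = cl v" if "A \<in> carrier ?Q" for A
    using that by (auto simp: carrier)
  have inj: "inj_on \<psi> (carrier ?Q)"
  proof (rule inj_onI)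
    fix A B assume "A \<in> carrier ?Q" "B \<in> carrier ?Q" "\<psi> A = \<psi> B"
    moreover from this obtain v w where "v \<in> carrier M" "A = cl v" "w \<in> carrier M" "B = cl w"
      using Q by metis
    ultimately show "A = B" by (simp add: \<psi> cl_cong[of v w])
  qed
  have \<psi>_add: "A \<oplus>\<^bsub>?Q\<^esub> B \<in> carrier ?Q \<and> \<psi> (A \<oplus>\<^bsub>?Q\<^esub> B) = \<psi> A \<oplus>\<^bsub>N\<^esub> \<psi> B"
    if "A \<in> carrier ?Q" "B \<in> carrier ?Q" for A B
    using that[THEN Q] by (auto simp: add \<psi> hom_add clI)
  have \<psi>_smult: "c \<odot>\<^bsub>?Q\<^esub> A \<in> carrier ?Q \<and> \<psi> (c \<odot>\<^bsub>?Q\<^esub> A) = c \<odot>\<^bsub>N\<^esub> \<psi> A"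
    if "A \<in> carrier ?Q" for A c
    using that[THEN Q] by (auto simp: smult \<psi> hom_smult clI M.smult_closed_UNIV)
  have \<psi>_act: "act ?Q x A \<in> carrier ?Q \<and> \<psi> (act ?Q x A) = act N x (\<psi> A)"
    if "x \<in> carrier \<gg>" "A \<in> carrier ?Q" for A x
    using that(1) that(2)[THEN Q] by (auto simp: act \<psi> hom_act clI M.act_closed)
  have \<psi>_mem: "\<psi> A \<in> carrier N" if "A \<in> carrier ?Q" for A
    using that[THEN Q] by (auto simp: \<psi> hom_closed)
  have \<psi>_part: "part ?Q i = {A \<in> carrier ?Q. \<psi> A \<in> part N i}" for i
  proof (intro equalityI subsetI)
    fix A assume "A \<in> part ?Q i"
    then show "A \<in> {A \<in> carrier ?Q. \<psi> A \<in> part N i}"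
      by (auto simp: part \<psi> M.part_subset clI hom_part)
  next
    fix A assume "A \<in> {A \<in> carrier ?Q. \<psi> A \<in> part N i}"
    then obtain v where v: "v \<in> carrier M" "A = cl v" "\<phi> v \<in> part N i"
      by (auto simp: carrier \<psi>)
    then obtain u where "u \<in> part M i" "\<phi> u = \<phi> v" using part_lift by blast
    then show "A \<in> part ?Q i" using v cl_cong[of u v] by (auto simp: part)
  qed
  have split: "\<exists>U\<in>part ?Q 0. \<exists>W\<in>part ?Q 1. A = U \<oplus>\<^bsub>?Q\<^esub> W" if A: "A \<in> carrier ?Q" for A
  proof -
    obtain v where v: "v \<in> carrier M" "A = cl v" using Q[OF A] by blast
    obtain u w where "u \<in> part M 0" "w \<in> part M 1" "v = u \<oplus>\<^bsub>M\<^esub> w"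
      using M.part_sum[OF v(1)] by blast
    then show ?thesis
      using v by (intro bexI[of _ "cl u"] bexI[of _ "cl w"]) (simp_all add: part M.part_subset add)
  qed
  have "\<psi> ` carrier ?Q = carrier N"
  proof
    show "carrier N \<subseteq> \<psi> ` carrier ?Q"
    proof
      fix w assume "w \<in> carrier N"
      then obtain v where "v \<in> carrier M" "w = \<phi> v" using surj by blast
      then show "w \<in> \<psi> ` carrier ?Q"
        using \<psi>[of v] clI[of v] by (metis image_eqI)
    qed
  qed (use \<psi>_mem in blast)
  then have "supermodule_iso \<gg> ?Q N \<psi>"
    using inj \<psi>_add \<psi>_smult \<psi>_act \<psi>_part
    by (auto simp: supermodule_iso_def bij_betw_def)
  moreover have "lie_supermodule \<gg> ?Q"
    by (rule N.pullback_supermodule[where \<psi> = \<psi>, OF inj \<psi>_mem])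
      (use \<psi>_add \<psi>_smult \<psi>_act \<psi>_part split \<psi>[of "\<zero>\<^bsub>M\<^esub>"] clI[of "\<zero>\<^bsub>M\<^esub>"] hom_zero in
        \<open>auto simp: zero\<close>)
  ultimately show ?thesis
    using N.lie_supermodule_axioms by (auto simp: isomorphic_modules_def)
qed

end

lemma (in supermodule_hom) image_graded_submodule:
  assumes "graded_submodule \<gg> W M"
  shows "graded_submodule \<gg> (\<phi> ` W) N"
proof -
  from assms have sub: "submodule W complex_ring M"
    and split: "\<And>v. v \<in> W \<Longrightarrow> \<exists>u\<in>W \<inter> part M 0. \<exists>w\<in>W \<inter> part M 1. v = u \<oplus>\<^bsub>M\<^esub> w"
    and act: "\<And>x v. x \<in> carrier \<gg> \<Longrightarrow> v \<in> W \<Longrightarrow> act M x v \<in> W"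
    by (simp_all add: graded_submodule_def)
  note W = M.submoduleE[OF sub, unfolded complex_ring_simps]
  have mem: "v \<in> carrier M" if "v \<in> W" for v using W(1) that by blast
  have "submodule (\<phi> ` W) complex_ring N"
  proof (rule N.submoduleI)
    show "\<zero>\<^bsub>N\<^esub> \<in> \<phi> ` W"
      using subgroup.one_closed[OF submodule.axioms(1)[OF sub]] 
      by (intro image_eqI[of _ _ "\<zero>\<^bsub>M\<^esub>"]) (simp_all add: hom_zero)
  next
    fix w assume "w \<in> \<phi> ` W"
    then show "\<ominus>\<^bsub>N\<^esub> w \<in> \<phi> ` W"
      using W(3) by (auto simp: hom_uminus[symmetric] mem)
  next
    fix v w assume "v \<in> \<phi> ` W" "w \<in> \<phi> ` W"
    then show "v \<oplus>\<^bsub>N\<^esub> w \<in> \<phi> ` W"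
      using W(5) by (auto simp: hom_add[symmetric] mem)
  next
    fix c w assume "w \<in> \<phi> ` W"
    then show "c \<odot>\<^bsub>N\<^esub> w \<in> \<phi> ` W"
      using W(4) by (auto simp: hom_smult[symmetric] mem)
  qed (use mem hom_closed in blast)
  moreover have "\<exists>u\<in>\<phi> ` W \<inter> part N 0. \<exists>w\<in>\<phi> ` W \<inter> part N 1. \<phi> v = u \<oplus>\<^bsub>N\<^esub> w" if v: "v \<in> W" for v
  proof -
    obtain u w where "u \<in> W" "u \<in> part M 0" "w \<in> W" "w \<in> part M 1" "v = u \<oplus>\<^bsub>M\<^esub> w"
      using split[OF v] by blast
    then show ?thesis
      by (intro bexI[of _ "\<phi> u"] bexI[of _ "\<phi> w"]) (auto simp: hom_add mem hom_part)
  qed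
  moreover have "act N x (\<phi> v) \<in> \<phi> ` W" if "x \<in> carrier \<gg>" "v \<in> W" for x v
    using act[OF that] that by (simp add: hom_act[symmetric] mem)
  ultimately show ?thesis by (auto simp: graded_submodule_def)
qed

text \<open>
  An isomorphism maps graded submodules to graded submodules injectively, and maps the zero
  submodule and the whole module to their counterparts.
\<close>

lemma irreducible_module_iso:
  assumes iso: "isomorphic_modules \<gg> M N" and irr: "irreducible_module \<gg> N"
  shows "irreducible_module \<gg> M"
proof -
  from iso obtain \<phi> where mod: "lie_supermodule \<gg> M" "lie_supermodule \<gg> N"
    and \<phi>: "supermodule_iso \<gg> M N \<phi>"
    by (auto simp: isomorphic_modules_def)
  then have bij: "bij_betw \<phi> (carrier M) (carrier N)" by (simp add: supermodule_iso_def)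
  interpret supermodule_hom \<gg> M N \<phi>
    using mod \<phi> bij_betwE[OF bij]
    by (intro supermodule_hom.intro supermodule_hom_axioms.intro)
      (auto simp: supermodule_iso_def image_subset_iff)
  note inj = bij_betw_imp_inj_on[OF bij] and img = bij_betw_imp_surj_on[OF bij]
  have sub: "W = {\<zero>\<^bsub>M\<^esub>} \<or> W = carrier M" if W: "graded_submodule \<gg> W M" for W
  proof -
    have subset: "W \<subseteq> carrier M"
      using M.submoduleE(1) W by (auto simp: graded_submodule_def)
    have z: "\<phi> ` {\<zero>\<^bsub>M\<^esub>} = {\<zero>\<^bsub>N\<^esub>}" by (simp add: hom_zero)
    have "\<phi> ` W = \<phi> ` {\<zero>\<^bsub>M\<^esub>} \<or> \<phi> ` W = \<phi> ` carrier M"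
      using irr image_graded_submodule[OF W]
      by (simp add: irreducible_module_def z img del: image_insert)
    then show ?thesis
      using inj_on_image_eq_iff[OF inj] subset M.zero_closed by blast
  qed
  have "carrier M \<noteq> {\<zero>\<^bsub>M\<^esub>}"
  proof
    assume M: "carrier M = {\<zero>\<^bsub>M\<^esub>}"
    then have "carrier N = {\<zero>\<^bsub>N\<^esub>}" using img hom_zero by simp
    then show False using irr by (simp add: irreducible_module_def)
  qed
  then show ?thesis
    using sub mod by (auto simp: irreducible_module_def)
qed

section \<open>Translation of polynomials by 1\<close>

text \<open>
  Such a polynomial takes the value \<open>f(0)\<close> at all natural numbers, which are infinitely many in
  characteristic \<open>0\<close>.
\<close>

lemma degree_eq_0_if_translation_invariant:
  fixes f :: "'a::field_char_0 poly"
  assumes "f \<circ>\<^sub>p [:1, 1:] = f"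
  shows "degree f = 0"
proof -
  have step: "poly f (x + 1) = poly f x" for x
    using arg_cong[OF assms, of "\<lambda>p. poly p x"] by (simp add: poly_pcompose add.commute)
  have "poly f (of_nat n) = poly f 0" for n
    by (induction n) (use step in \<open>auto simp: add.commute[of 1]\<close>)
  then have "range of_nat \<subseteq> {x. poly (f - [:poly f 0:]) x = 0}" by auto
  moreover have "infinite (range (of_nat :: nat \<Rightarrow> 'a))"
    by (rule range_inj_infinite) (rule inj_of_nat)
  ultimately have "infinite {x. poly (f - [:poly f 0:]) x = 0}"
    using finite_subset by blast
  then have "f - [:poly f 0:] = 0" using poly_roots_finite by blast
  then have "f = [:poly f 0:]" by simp
  then show ?thesis by (metis degree_pCons_0)
qed

text \<open>The leading terms of \<open>f(x + 1)\<close> and \<open>f(x)\<close> agree and cancel.\<close>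

lemma degree_translation_diff:
  fixes f :: "'a::field_char_0 poly"
  assumes "degree f > 0"
  shows "degree (f \<circ>\<^sub>p [:1, 1:] - f) < degree f"
proof (rule ccontr)
  let ?d = "f \<circ>\<^sub>p [:1, 1:] - f"
  assume "\<not> ?thesis"
  moreover have "degree ?d \<le> degree f" by (rule degree_diff_le) (simp_all add: degree_pcompose)
  ultimately have deg: "degree ?d = degree f" by simp
  have "lead_coeff (f \<circ>\<^sub>p [:1, 1:]) = lead_coeff f" by (subst lead_coeff_comp) auto
  then have "lead_coeff ?d = 0" unfolding deg by (simp add: degree_pcompose)
  then have "?d = 0" using leading_coeff_0_iff by blast
  then show False using deg assms by simp
qed

text \<open>
  A nonzero element \<open>f\<close> of least degree is constant, since otherwise \<open>f(x + 1) - f(x)\<close> would be a nonzero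
  element of smaller degree.
\<close>

lemma translation_invariant_subspace_contains_1:
  fixes I :: "'a::field_char_0 poly set"
  assumes diff: "\<And>f h. f \<in> I \<Longrightarrow> h \<in> I \<Longrightarrow> f - h \<in> I"
    and smult: "\<And>c f. f \<in> I \<Longrightarrow> Polynomial.smult c f \<in> I"
    and trans: "\<And>f. f \<in> I \<Longrightarrow> f \<circ>\<^sub>p [:1, 1:] \<in> I"
    and nz: "f0 \<in> I" "f0 \<noteq> 0"
  shows "1 \<in> I"
proof -
  obtain f where f: "f \<in> I" "f \<noteq> 0" and min: "\<And>h. h \<in> I \<Longrightarrow> h \<noteq> 0 \<Longrightarrow> degree f \<le> degree h"
    using ex_has_least_nat[of "\<lambda>f. f \<in> I \<and> f \<noteq> 0" f0 degree] nz by auto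
  have "degree f = 0"
  proof (rule ccontr)
    assume pos: "degree f \<noteq> 0"
    then have "f \<circ>\<^sub>p [:1, 1:] - f \<noteq> 0"
      using degree_eq_0_if_translation_invariant[of f] by auto
    then have "degree f \<le> degree (f \<circ>\<^sub>p [:1, 1:] - f)"
      using f by (intro min diff trans)
    then show False using degree_translation_diff[of f] pos by simp
  qed
  then obtain c where c: "f = [:c:]" by (rule degree_eq_zeroE)
  then have "Polynomial.smult (inverse c) f = 1" using f by (simp add: one_pCons)
  then show ?thesis using smult[OF f(1)] by metis
qed

section \<open>Irreducibility of \<open>\<Phi>(\<lambda>, b)\<close> for nonzero \<open>b\<close>\<close>

lemma act_pair_module_single:
  assumes "vector_space scale"
  shows "act (ns_pair_module scale A) (Poly_Mapping.single a 1) v = A a v"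
  using vector_space.vector_space_assms(4)[OF assms]
  by (cases "A a v") (simp add: ns_pair_module_def linear_ext_def)

lemma vector_space_K1: "vector_space (\<lambda>c f. K1 c * f)"
  by unfold_locales (simp_all add: algebra_simps smult_add_left smult_add_right)

lemma Phi_simps:
  "carrier (Phi lam b) = UNIV" "add (Phi lam b) = (+)" "\<zero>\<^bsub>Phi lam b\<^esub> = (0, 0)"
  "c \<odot>\<^bsub>Phi lam b\<^esub> (f, h) = (K1 c * f, K1 c * h)"
  "part (Phi lam b) 0 = {v. snd v = 0}" "part (Phi lam b) 1 = {v. fst v = 0}"
  by (simp_all add: Phi_def ns_pair_module_def zero_prod_def)

text \<open>
  The condition \<open>b \<noteq> 0\<close> enters where the even part of a submodule is shown to be stable under
  translation by \<open>1\<close>; for \<open>b = 0\<close> the pair \<open>x \<complex>[x] \<oplus> \<complex>[s]\<close> is a proper submodule.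
\<close>

theorem Phi_irreducible:
  assumes lam: "lam \<noteq> 0" and b: "b \<noteq> 0"
  shows "irreducible_module ns_algebra (Phi lam b)"
proof -
  interpret Phi: lie_supermodule ns_algebra "Phi lam b" by (rule Phi_module) fact
  have "W = UNIV" if W: "graded_submodule ns_algebra W (Phi lam b)" and "W \<noteq> {(0, 0)}" for W
  proof -
    have sub: "submodule W complex_ring (Phi lam b)"
      using W by (simp add: graded_submodule_def)
    note S = Phi.submoduleE[OF sub, unfolded complex_ring_simps Phi_simps]
    have add: "v + w \<in> W" if "v \<in> W" "w \<in> W" for v w
      using S(5) that by blast
    have scale: "(Polynomial.smult c f, Polynomial.smult c h) \<in> W" if "(f, h) \<in> W" for c f h
      using S(4)[of c "(f, h)"] that by (simp add: Phi_simps)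
    have act: "Phi_act lam b a v \<in> W" if "v \<in> W" for a v
    proof -
      have "act (Phi lam b) (Poly_Mapping.single a 1) v \<in> W"
        using W that by (auto simp: graded_submodule_def ns_algebra_simps)
      then show ?thesis
        unfolding Phi_def by (simp only: act_pair_module_single[OF vector_space_K1])
    qed
    define I where "I = {f. (f, 0) \<in> W}"
    have I_add: "f + h \<in> I" if "f \<in> I" "h \<in> I" for f h
      using add[of "(f, 0)" "(h, 0)"] that by (simp add: I_def)
    have I_smult: "Polynomial.smult c f \<in> I" if "f \<in> I" for c f
      using scale[of f 0 c] that by (simp add: I_def)
    have I_diff: "f - h \<in> I" if "f \<in> I" "h \<in> I" for f h
      using I_add[OF that(1) I_smult[OF that(2), of "-1"]] by simp
    have I_X: "X1 * f \<in> I" if "f \<in> I" for f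
      using act[of "(f, 0)" "Lgen 0"] that by (simp add: I_def)
    have I_trans: "f \<circ>\<^sub>p [:1, 1:] \<in> I" if "f \<in> I" for f
    proof -
      \<comment> \<open>The products \<open>G\<^bsub>1/2\<^esub> G\<^bsub>1/2\<^esub>\<close> and \<open>G\<^bsub>-1/2\<^esub> G\<^bsub>3/2\<^esub>\<close> both translate by \<open>1\<close>, with the
        different linear factors \<open>x + b\<close> and \<open>x - b\<close>.\<close>
      let ?f = "f \<circ>\<^sub>p [:1, 1:]"
      have c: "pcompose (pcompose f [:1/2, 1:]) [:1/2, 1:] = ?f"
        "pcompose (pcompose f [:3/2, 1:]) [:-1/2, 1:] = ?f"
        by (simp_all add: pcompose_assoc[symmetric] pcompose_pCons)
      have "Phi_act lam b (Ggen 0) (Phi_act lam b (Ggen 0) (f, 0)) =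
          (Polynomial.smult lam ([:b, 1:] * ?f), 0)"
        using c(1) by (simp add: smult_add_right ac_simps)
      then have 1: "Polynomial.smult lam ([:b, 1:] * ?f) \<in> I"
        using act[OF act, of "(f, 0)" "Ggen 0" "Ggen 0"] that unfolding I_def by simp
      have "Phi_act lam b (Ggen (-1)) (Phi_act lam b (Ggen 1) (f, 0)) =
          (Polynomial.smult lam ([:-b, 1:] * ?f), 0)"
        using c(2) by (simp add: smult_add_right smult_diff_right pcompose_smult ac_simps)
      then have 2: "Polynomial.smult lam ([:-b, 1:] * ?f) \<in> I"
        using act[OF act, of "(f, 0)" "Ggen (-1)" "Ggen 1"] that unfolding I_def by simp
      have "Polynomial.smult lam ([:b, 1:] * ?f) - Polynomial.smult lam ([:-b, 1:] * ?f)
          = Polynomial.smult (2 * b * lam) ?f"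
        by (simp add: smult_diff_right[symmetric] smult_add_left[symmetric] algebra_simps)
      then have "Polynomial.smult (2 * b * lam) ?f \<in> I"
        using I_diff[OF 1 2] by simp
      moreover have "2 * b * lam \<noteq> 0" using b lam by simp
      ultimately show ?thesis
        using I_smult[of "Polynomial.smult (2 * b * lam) ?f" "inverse (2 * b * lam)"]
        by (metis smult_smult left_inverse smult_1_left)
    qed
    have "\<exists>f\<in>I. f \<noteq> 0"
    proof -
      obtain v where v: "v \<in> W" "v \<noteq> (0, 0)"
        using S(2) \<open>W \<noteq> {(0, 0)}\<close> by auto
      then obtain f h where fh: "(f, 0) \<in> W" "(0, h) \<in> W" "v = (f, 0) + (0, h)"
        using W by (fastforce simp: graded_submodule_def Phi_simps)
      show ?thesis
      proof (cases "f = 0")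
        case False
        with fh show ?thesis by (auto simp: I_def)
      next
        case True
        \<comment> \<open>A nonzero odd element \<open>h\<close> is sent by \<open>G\<^bsub>1/2\<^esub>\<close> to a nonzero even one.\<close>
        then have "h \<noteq> 0" using v fh by auto
        then have "h \<circ>\<^sub>p [:1/2, 1:] \<noteq> 0" by (subst pcompose_eq_0_iff) auto
        moreover have "Phi_act lam b (Ggen 0) (0, h) =
            (Polynomial.smult lam ([:b, 1:] * h \<circ>\<^sub>p [:1/2, 1:]), 0)"
          by (simp add: smult_add_right ac_simps)
        ultimately have "(Polynomial.smult lam ([:b, 1:] * h \<circ>\<^sub>p [:1/2, 1:])) \<in> I \<and>
            Polynomial.smult lam ([:b, 1:] * h \<circ>\<^sub>p [:1/2, 1:]) \<noteq> 0"
          using act[OF fh(2), of "Ggen 0"] lam unfolding I_def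
          by (simp del: Phi_act.simps mult_pCons_left)
        then show ?thesis by blast
      qed
    qed
    then have "1 \<in> I"
      using translation_invariant_subspace_contains_1[of I] I_diff I_smult I_trans by blast
    have I: "f \<in> I" for f
    proof (induction f)
      case 0
      show ?case using I_smult[OF \<open>1 \<in> I\<close>, of 0] by simp
    next
      case (pCons a p)
      have "pCons a p = Polynomial.smult a 1 + X1 * p" by simp
      then show ?case using I_add[OF I_smult[OF \<open>1 \<in> I\<close>] I_X[OF pCons.IH]] by metis
    qed
    have odd: "(0, h) \<in> W" for h
    proof -
      have "pcompose (pcompose h [:-1/2, 1:]) [:1/2, 1:] = h"
        by (simp add: pcompose_assoc[symmetric] pcompose_pCons)
      then have "Phi_act lam b (Ggen 0) (h \<circ>\<^sub>p [:-1/2, 1:], 0) = (0, h)" by simp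
      then show ?thesis using act[of "(h \<circ>\<^sub>p [:-1/2, 1:], 0)" "Ggen 0"] I by (simp add: I_def)
    qed
    show ?thesis
    proof (intro UNIV_eq_I[symmetric])
      fix v :: "complex poly \<times> complex poly"
      show "v \<in> W" using add[of "(fst v, 0)" "(0, snd v)"] I odd by (simp add: I_def)
    qed
  qed
  moreover have "(UNIV :: (complex poly \<times> complex poly) set) \<noteq> {(0, 0)}"
    by (metis UNIV_I prod.inject singletonD zero_neq_one)
  ultimately show ?thesis
    unfolding irreducible_module_def Phi_simps using Phi.lie_supermodule_axioms by blast
qed

section \<open>Specialising \<open>y\<close> to \<open>b\<close>\<close>

definition evalY :: "complex \<Rightarrow> complex poly poly \<Rightarrow> complex poly" where
  "evalY b = map_poly (\<lambda>c. poly c b)"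

lemma coeff_evalY: "coeff (evalY b f) n = poly (coeff f n) b"
  by (simp add: evalY_def coeff_map_poly)

lemma evalY_pCons: "evalY b (pCons c f) = pCons (poly c b) (evalY b f)"
  by (simp add: evalY_def map_poly_pCons)

lemma evalY_0: "evalY b 0 = 0"
  by (simp add: evalY_def)

lemma evalY_add: "evalY b (f + h) = evalY b f + evalY b h"
  by (rule poly_eqI) (simp add: coeff_evalY)

lemma evalY_mult: "evalY b (f * h) = evalY b f * evalY b h"
  by (rule poly_eqI) (simp add: coeff_evalY coeff_mult poly_sum)

lemma evalY_pcompose: "evalY b (f \<circ>\<^sub>p q) = evalY b f \<circ>\<^sub>p evalY b q"
  by (induction f) (simp_all add: pcompose_pCons evalY_pCons evalY_0 evalY_add evalY_mult)

lemma evalY_eq_0_iff: "evalY b f = 0 \<longleftrightarrow> (\<exists>q. f = Polynomial.smult [:- b, 1:] q)"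
proof -
  have "evalY b f = 0 \<longleftrightarrow> (\<forall>n. [:- b, 1:] dvd coeff f n)"
    by (simp add: poly_eq_iff coeff_evalY poly_eq_0_iff_dvd)
  also have "\<dots> \<longleftrightarrow> [:[:- b, 1:]:] dvd f" by (simp add: const_poly_dvd_iff)
  finally show ?thesis by (simp add: dvd_def)
qed

text \<open>
  All operators of \<open>\<Psi>(\<lambda>)\<close> are built from multiplications and from substitutions for \<open>x\<close>, which the
  ring homomorphism \<open>evalY b\<close> respects, and it sends their coefficients to those of \<open>\<Phi>(\<lambda>, b)\<close>.
\<close>

lemma evalY_Psi_act:
  "map_prod (evalY b) (evalY b) (Psi_act lam a v) = Phi_act lam b a (map_prod (evalY b) (evalY b) v)"
proof -
  have gens: "evalY b (K2 c) = K1 c" "evalY b X2 = X1" "evalY b Y2 = K1 b" for c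
    by (simp_all add: evalY_pCons evalY_0)
  show ?thesis
    by (cases a; cases v)
      (simp_all only: Psi_act.simps Phi_act.simps map_prod_simp evalY_mult evalY_add
          evalY_pcompose gens evalY_0,
       simp_all add: algebra_simps)
qed

lemma Psi_act_smult:
  "Psi_act lam a (Polynomial.smult h f1, Polynomial.smult h f2) =
    map_prod (Polynomial.smult h) (Polynomial.smult h) (Psi_act lam a (f1, f2))"
  by (cases a) (simp_all only: Psi_act.simps pcompose_smult mult_smult_right map_prod_simp smult_0_right)

text \<open>
  For \<open>h \<noteq> 0\<close> this sends a multiple \<open>h(y) f(x, y)\<close> to \<open>f(x, b)\<close>. Euclidean division by \<open>h\<close> is linear
  also on polynomials that \<open>h\<close> does not divide, which makes the map linear on all of \<open>\<complex>[x, y]\<close>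
  without a choice of \<open>f\<close>.
\<close>

definition divide_evalY :: "complex poly \<Rightarrow> complex \<Rightarrow> complex poly poly \<Rightarrow> complex poly" where
  "divide_evalY h b = map_poly (\<lambda>c. poly (c div h) b)"

lemma coeff_divide_evalY: "coeff (divide_evalY h b f) n = poly (coeff f n div h) b"
  by (simp add: divide_evalY_def coeff_map_poly)

lemma divide_evalY_add: "divide_evalY h b (f + q) = divide_evalY h b f + divide_evalY h b q"
  by (rule poly_eqI) (simp add: coeff_divide_evalY poly_div_add_left)

lemma divide_evalY_scale: "divide_evalY h b (K2 c * f) = K1 c * divide_evalY h b f"
  by (rule poly_eqI) (simp add: coeff_divide_evalY div_smult_left)

lemma divide_evalY_smult: "h \<noteq> 0 \<Longrightarrow> divide_evalY h b (Polynomial.smult h f) = evalY b f"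
  by (rule poly_eqI) (simp add: coeff_divide_evalY coeff_evalY)

lemma Psi_simps:
  "carrier (Psi lam) = UNIV" "add (Psi lam) = (+)" "\<zero>\<^bsub>Psi lam\<^esub> = (0, 0)"
  "module.smult (Psi lam) = (\<lambda>c. pair_scale (\<lambda>c f. K2 c * f) c)"
  "part (Psi lam) i = (if i = 0 then {v. snd v = 0} else {v. fst v = 0})"
  by (simp_all add: Psi_def ns_pair_module_def zero_prod_def)

text \<open>
  Compatibility with the action holds only on \<open>R\<^sub>h\<close>: there \<open>h\<close> can be pulled out of the action by
  \<open>Psi_act_smult\<close>, after which \<open>evalY_Psi_act\<close> applies. A polynomial without \<open>y\<close>, multiplied by \<open>h\<close>, is a
  preimage of that polynomial.
\<close>

lemma divide_evalY_epi:
  fixes lam b :: complex and h :: "complex poly"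
  assumes lam: "lam \<noteq> 0" and h: "h \<noteq> 0"
  defines "\<phi> \<equiv> map_prod (divide_evalY h b) (divide_evalY h b)"
  shows "supermodule_epi ns_algebra (restrict_module (Psi lam) (R_ns h)) (Phi lam b) \<phi>"
proof -
  interpret Psi: lie_supermodule ns_algebra "Psi lam" by (rule Psi_module) fact
  let ?M = "restrict_module (Psi lam) (R_ns h)"
  have \<phi>_smult: "\<phi> (Polynomial.smult h f1, Polynomial.smult h f2) = (evalY b f1, evalY b f2)" for f1 f2
    using h by (simp add: \<phi>_def divide_evalY_smult)
  have \<phi>_add: "\<phi> (v + w) = \<phi> v + \<phi> w" for v w
    by (cases v; cases w) (simp add: \<phi>_def divide_evalY_add)
  have \<phi>_scale: "\<phi> (pair_scale (\<lambda>c f. K2 c * f) c v) = pair_scale (\<lambda>c f. K1 c * f) c (\<phi> v)" for c v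
    by (cases v) (simp add: \<phi>_def divide_evalY_scale del: mult_pCons_left)
  have \<phi>_0: "\<phi> 0 = 0" using \<phi>_add[of 0 0] by simp
  have d0: "divide_evalY h b 0 = 0" using divide_evalY_add[of h b 0 0] by simp
  have basis: "\<phi> (Psi_act lam a v) = Phi_act lam b a (\<phi> v)" if v_R: "v \<in> R_ns h" for a v
  proof -
    obtain f1 f2 where v: "v = (Polynomial.smult h f1, Polynomial.smult h f2)"
      using v_R by (auto simp: R_ns_def)
    obtain q1 q2 where q: "Psi_act lam a (f1, f2) = (q1, q2)" by fastforce
    have "\<phi> (Psi_act lam a v) = map_prod (evalY b) (evalY b) (Psi_act lam a (f1, f2))"
      unfolding v Psi_act_smult q by (simp add: \<phi>_smult)
    also have "\<dots> = Phi_act lam b a (\<phi> v)"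
      unfolding evalY_Psi_act v \<phi>_smult by simp
    finally show ?thesis .
  qed
  have act: "\<phi> (act (Psi lam) x v) = act (Phi lam b) x (\<phi> v)" if v: "v \<in> R_ns h" for x v
  proof -
    have "\<phi> (\<Sum>a\<in>B. pair_scale (\<lambda>c f. K2 c * f) (Poly_Mapping.lookup x a) (Psi_act lam a v)) =
      (\<Sum>a\<in>B. pair_scale (\<lambda>c f. K1 c * f) (Poly_Mapping.lookup x a) (Phi_act lam b a (\<phi> v)))"
      if "finite B" for B
      using that
    proof (induction B rule: finite_induct)
      case (insert a B)
      then show ?case by (simp add: \<phi>_add \<phi>_scale basis[OF v] del: mult_pCons_left)
    qed (simp add: \<phi>_0)
    then show ?thesis
      by (simp only: Psi_def Phi_def ns_pair_module_def linear_ext_def lie_supermodule.simps finite_keys)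
  qed
  show ?thesis
  proof (intro supermodule_epi.intro supermodule_hom.intro Phi_module[OF lam]
      Psi.restrict_module_supermodule R_ns_submodule[OF lam]
      supermodule_hom_axioms.intro supermodule_epi_axioms.intro)
    fix w assume "w \<in> carrier (Phi lam b)"
    have ev: "evalY b (map_poly (\<lambda>c. [:c:]) q) = q" for q
      by (rule poly_eqI) (simp add: coeff_evalY coeff_map_poly)
    obtain q1 q2 where w: "w = (q1, q2)" by fastforce
    let ?v = "(Polynomial.smult h (map_poly (\<lambda>c. [:c:]) q1),
      Polynomial.smult h (map_poly (\<lambda>c. [:c:]) q2))"
    have "?v \<in> R_ns h" by (auto simp: R_ns_def)
    moreover have "w = \<phi> ?v" by (simp add: \<phi>_smult ev w)
    ultimately show "\<exists>v\<in>carrier ?M. w = \<phi> v"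
      by (auto simp: restrict_module_def)
  next
    fix v i assume "v \<in> part ?M i"
    then show "\<phi> v \<in> part (Phi lam b) i"
      by (cases v; cases i) (auto simp: restrict_module_def Psi_simps Phi_simps \<phi>_def d0)
  next
    fix v c assume "v \<in> carrier ?M"
    then show "\<phi> (c \<odot>\<^bsub>?M\<^esub> v) = c \<odot>\<^bsub>Phi lam b\<^esub> \<phi> v"
      using \<phi>_scale[of c v]
      by (cases "\<phi> v") (simp add: restrict_module_def Psi_simps Phi_simps del: mult_pCons_left)
  qed (auto simp: restrict_module_def Psi_simps Phi_simps \<phi>_add act)
qed

lemma divide_evalY_kernel:
  assumes "h \<noteq> 0"
  shows "{v \<in> R_ns h. map_prod (divide_evalY h b) (divide_evalY h b) v = (0, 0)} =
    R_ns ([:- b, 1:] * h)"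
proof -
  have "{v \<in> R_ns h. map_prod (divide_evalY h b) (divide_evalY h b) v = (0, 0)} =
      {(Polynomial.smult h f1, Polynomial.smult h f2) | f1 f2. evalY b f1 = 0 \<and> evalY b f2 = 0}"
    unfolding R_ns_def
    by (intro equalityI subsetI; clarsimp simp: assms divide_evalY_smult)
      (use assms in \<open>auto simp: divide_evalY_smult\<close>)
  also have "\<dots> = R_ns ([:- b, 1:] * h)"
    unfolding evalY_eq_0_iff R_ns_def by (force simp: mult.commute[of h])
  finally show ?thesis .
qed

theorem proposition5p8:
  fixes lam b :: complex and g g' :: "complex poly"
  assumes "lam \<noteq> 0" and "g \<noteq> 0" and "g' \<noteq> 0"
    and "g = [:- b, 1:] * g'"
  shows "let Q = quotient_module (restrict_module (Psi lam) (R_ns g')) (R_ns g) in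
    isomorphic_modules ns_algebra Q (Phi lam b) \<and>
    (b \<noteq> 0 \<longrightarrow> irreducible_module ns_algebra Q)"
proof -
  interpret supermodule_epi ns_algebra "restrict_module (Psi lam) (R_ns g')" "Phi lam b"
      "map_prod (divide_evalY g' b) (divide_evalY g' b)"
    by (rule divide_evalY_epi) fact+
  have "ker = R_ns g"
    unfolding ker_def using divide_evalY_kernel[of g' b] assms
    by (simp add: restrict_module_def Phi_simps del: mult_pCons_left)
  with first_isomorphism
  have iso: "isomorphic_modules ns_algebra
      (quotient_module (restrict_module (Psi lam) (R_ns g')) (R_ns g)) (Phi lam b)"
    by simp
  then show ?thesis
    using irreducible_module_iso[OF iso Phi_irreducible] assms(1) by (simp add: Let_def)
qed

end
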